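(* Let $\Gamma$ be a group with a self-similar action on a row-finite directed graph $E$ without sources, and let $E_\Gamma$ be the quotient graph. There are natural isomorphisms of preordered monoids $$W(\Gamma,E)\cong W(E_\Gamma),\qquad V(\Gamma,E)\cong V(E_\Gamma).$$ In particular, these monoids are unperforated.
   Context: SELF-SIMILAR ACTIONS. $E=(E^0,E^1,r,s)$; row-finite without sources means $r^{-1}(v)$ is finite and nonempty for all $v\in E^0$. $\Gamma$ acts on $E$ by graph automorphisms and there is a restriction map $\Gamma\times E^1\ni(g,e)\mapsto g|_e\in\Gamma$ with $(gh)|_e=g|_{he}\,h|_e$ and $g|_e\,s(e)=g\,s(e)$ for all $g,h\in\Gamma$, $e\in E^1$. QUOTIENT GRAPH. Choose a set $\Omega\subseteq E^0$ of representatives for the $\Gamma$-orbits in $E^0$. Then $E_\Gamma$ has vertex set $E^0/\Gamma=\{[v]:v\in E^0\}$, edge set $\bigcup_{v\in\Omega}r^{-1}(v)\subseteq E^1$, and range and source maps $e\mapsto[r(e)]$, $e\mapsto[s(e)]$. It is a row-finite graph without sources, independent of $\Omega$ up to isomorphism. MONOIDS. $E^nv$ is the set of paths $\lambda=e_1\cdots e_n$ (with $s(e_i)=r(e_{i+1})$) of length $n$ with source $v$. $\mathrm C_c(E^0,\mathbb N)$ is the monoid of finitely supported functions $E^0\to\mathbb N$; $\Theta^n(f)(v)=\sum_{\lambda\in E^nv}f(r(\lambda))$, $\Theta^0=\mathrm{id}$. Write - $f\sim_\Theta\tilde f$ if $\Theta^p(f)=\Theta^q(\tilde f)$ for some $p,q\in\mathbb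 N$; - $f\sim_\Gamma\tilde f$ if there is $g\in\Gamma$ with $f(v)=\tilde f(gv)$ for all $v$; - $f\sim\tilde f$ if there are $f_i,\tilde f_i,\tilde{\tilde f}_i$ in $\mathrm C_c(E^0,\mathbb N)$, $i=1,\dots,n$, with $f_i\sim_\Gamma\tilde f_i\sim_\Theta\tilde{\tilde f}_i$, $f\sim_\Theta\sum_if_i$ and $\sum_i\tilde{\tilde f}_i\sim_\Theta\tilde f$; - $f\precsim\tilde f$ if there are such $f_i,\tilde f_i,\tilde{\tilde f}_i$ and $\tilde{\tilde f}\in\mathrm C_c(E^0,\mathbb N)$ with $f_i\sim_\Gamma\tilde f_i\sim_\Theta\tilde{\tilde f}_i$, $f\sim_\Theta\sum_if_i$ and $\sum_i\tilde{\tilde f}_i\le\tilde{\tilde f}\sim_\Theta\tilde f$; - $f\approx\tilde f$ if $f\precsim\tilde f$ and $\tilde f\precsim f$. These give preordered monoids $W(\Gamma,E)=\mathrm C_c(E^0,\mathbb N)/{\approx}$, ordered by $\precsim$, and $V(\Gamma,E)=\mathrm C_c(E^0,\mathbb N)/{\sim}$, with the algebraic preorder ($x\le y$ iff $x+z=y$ for some $z$). For trivial $\Gamma$ they are denoted $W(E)$, $V(E)$. The natural maps send the class of $1_{\{v\}}$ to the class of $1_{\{[v]\}}$. A preordered monoid is unperforated if $nx\le ny$ for some $n\ge1$ implies $x\le y$. *)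

theory Defs
  imports
    "HOL-Algebra.Group_Action"
    "HOL-Algebra.Elementary_Groups"
    "HOL-Library.Indicator_Function"
    "Graph_Theory.Digraph"
begin

section \<open>Graphs and self-similar actions\<close>

text \<open>
  The range map \<open>r\<close> is \<open>head\<close> and the source map \<open>s\<close> is \<open>tail\<close>, so \<open>in_arcs E v\<close> is \<open>r\<^sup>-\<^sup>1(v)\<close>.
\<close>

locale row_finite_no_sources = wf_digraph E
  for E :: "('v, 'e) pre_digraph" (structure) +
  assumes finite_in_arcs: "v \<in> verts E \<Longrightarrow> finite (in_arcs E v)"
    and in_arcs_nonempty: "v \<in> verts E \<Longrightarrow> in_arcs E v \<noteq> {}"

text \<open>
  The action by graph automorphisms is given by its action \<open>\<alpha>\<close> on vertices and its action \<open>\<beta>\<close>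
  on edges; \<open>res g e\<close> is the restriction \<open>g|\<^sub>e\<close>.
\<close>

locale self_similar_action =
  wf_digraph E + vertices: group_action \<Gamma> "verts E" \<alpha> + edges: group_action \<Gamma> "arcs E" \<beta>
  for \<Gamma> :: "('g, 'm) monoid_scheme" (structure)
    and E :: "('v, 'e) pre_digraph"
    and \<alpha> :: "'g \<Rightarrow> 'v \<Rightarrow> 'v"
    and \<beta> :: "'g \<Rightarrow> 'e \<Rightarrow> 'e" +
  fixes res :: "'g \<Rightarrow> 'e \<Rightarrow> 'g"
  assumes range_equivariant:
      "\<lbrakk>g \<in> carrier \<Gamma>; e \<in> arcs E\<rbrakk> \<Longrightarrow> head E (\<beta> g e) = \<alpha> g (head E e)"
    and source_equivariant:
      "\<lbrakk>g \<in> carrier \<Gamma>; e \<in> arcs E\<rbrakk> \<Longrightarrow> tail E (\<beta> g e) = \<alpha> g (tail E e)"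
    and res_closed:
      "\<lbrakk>g \<in> carrier \<Gamma>; e \<in> arcs E\<rbrakk> \<Longrightarrow> res g e \<in> carrier \<Gamma>"
    and res_mult:
      "\<lbrakk>g \<in> carrier \<Gamma>; h \<in> carrier \<Gamma>; e \<in> arcs E\<rbrakk>
        \<Longrightarrow> res (g \<otimes>\<^bsub>\<Gamma>\<^esub> h) e = res g (\<beta> h e) \<otimes>\<^bsub>\<Gamma>\<^esub> res h e"
    and res_source:
      "\<lbrakk>g \<in> carrier \<Gamma>; e \<in> arcs E\<rbrakk> \<Longrightarrow> \<alpha> (res g e) (tail E e) = \<alpha> g (tail E e)"

definition orbit_representatives ::
  "('g, 'm) monoid_scheme \<Rightarrow> ('v, 'e) pre_digraph \<Rightarrow> ('g \<Rightarrow> 'v \<Rightarrow> 'v) \<Rightarrow> 'v set \<Rightarrow> bool" where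
  "orbit_representatives \<Gamma> E \<alpha> \<Omega> \<longleftrightarrow>
     \<Omega> \<subseteq> verts E \<and> (\<forall>X \<in> orbits \<Gamma> (verts E) \<alpha>. \<exists>!v. v \<in> \<Omega> \<and> v \<in> X)"

definition quotient_graph ::
  "('g, 'm) monoid_scheme \<Rightarrow> ('v, 'e) pre_digraph \<Rightarrow> ('g \<Rightarrow> 'v \<Rightarrow> 'v) \<Rightarrow> 'v set
    \<Rightarrow> ('v set, 'e) pre_digraph" where
  "quotient_graph \<Gamma> E \<alpha> \<Omega> =
     \<lparr>verts = orbits \<Gamma> (verts E) \<alpha>,
      arcs = (\<Union>v\<in>\<Omega>. in_arcs E v),
      tail = (\<lambda>e. orbit \<Gamma> \<alpha> (tail E e)),
      head = (\<lambda>e. orbit \<Gamma> \<alpha> (head E e))\<rparr>"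

section \<open>Relations on finitely supported functions\<close>

text \<open>Functions on \<open>E\<^sup>0\<close> are represented by functions on the type that vanish off \<open>verts E\<close>.\<close>

definition Cc :: "('v, 'e) pre_digraph \<Rightarrow> ('v \<Rightarrow> nat) set" where
  "Cc E = {f. {v. f v \<noteq> 0} \<subseteq> verts E \<and> finite {v. f v \<noteq> 0}}"

text \<open>
  A path \<open>e\<^sub>1\<dots>e\<^sub>n\<close> is the list \<open>[e\<^sub>1, \<dots>, e\<^sub>n]\<close>. The path of length \<open>0\<close> at any vertex is \<open>[]\<close>,
  so the range depends on the source \<open>v\<close> as well.
\<close>

definition paths_from :: "('v, 'e) pre_digraph \<Rightarrow> nat \<Rightarrow> 'v \<Rightarrow> 'e list set" where
  "paths_from E n v =
     {es. length es = n \<and> set es \<subseteq> arcs E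
        \<and> (\<forall>i. Suc i < n \<longrightarrow> tail E (es ! i) = head E (es ! Suc i))
        \<and> (es \<noteq> [] \<longrightarrow> tail E (last es) = v)}"

definition path_range :: "('v, 'e) pre_digraph \<Rightarrow> 'v \<Rightarrow> 'e list \<Rightarrow> 'v" where
  "path_range E v es = (if es = [] then v else head E (hd es))"

text \<open>
  A vertex may emit infinitely many paths of length \<open>n\<close>, but only finitely many of them end in the
  support of \<open>f\<close>. Therefore the sum is \<open>sum'\<close>, which ignores zero summands, and not \<open>sum\<close>, which
  is \<open>0\<close> on every infinite index set.
\<close>

definition Theta :: "('v, 'e) pre_digraph \<Rightarrow> nat \<Rightarrow> ('v \<Rightarrow> nat) \<Rightarrow> 'v \<Rightarrow> nat" where
  "Theta E n f v = sum' (\<lambda>es. f (path_range E v es)) (paths_from E n v)"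

definition sim_Theta :: "('v, 'e) pre_digraph \<Rightarrow> ('v \<Rightarrow> nat) \<Rightarrow> ('v \<Rightarrow> nat) \<Rightarrow> bool" where
  "sim_Theta E f f' \<longleftrightarrow> (\<exists>p q. Theta E p f = Theta E q f')"

definition sim_Gamma ::
  "('g, 'm) monoid_scheme \<Rightarrow> ('v, 'e) pre_digraph \<Rightarrow> ('g \<Rightarrow> 'v \<Rightarrow> 'v)
    \<Rightarrow> ('v \<Rightarrow> nat) \<Rightarrow> ('v \<Rightarrow> nat) \<Rightarrow> bool" where
  "sim_Gamma \<Gamma> E \<alpha> f f' \<longleftrightarrow> (\<exists>g \<in> carrier \<Gamma>. \<forall>v \<in> verts E. f v = f' (\<alpha> g v))"

definition sim ::
  "('g, 'm) monoid_scheme \<Rightarrow> ('v, 'e) pre_digraph \<Rightarrow> ('g \<Rightarrow> 'v \<Rightarrow> 'v)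
    \<Rightarrow> ('v \<Rightarrow> nat) \<Rightarrow> ('v \<Rightarrow> nat) \<Rightarrow> bool" where
  "sim \<Gamma> E \<alpha> f f' \<longleftrightarrow>
     (\<exists>(n::nat) f1 f2 f3.
        (\<forall>i \<in> {1..n}. f1 i \<in> Cc E \<and> f2 i \<in> Cc E \<and> f3 i \<in> Cc E
            \<and> sim_Gamma \<Gamma> E \<alpha> (f1 i) (f2 i) \<and> sim_Theta E (f2 i) (f3 i))
      \<and> sim_Theta E f (\<lambda>v. \<Sum>i=1..n. f1 i v)
      \<and> sim_Theta E (\<lambda>v. \<Sum>i=1..n. f3 i v) f')"

definition precsim ::
  "('g, 'm) monoid_scheme \<Rightarrow> ('v, 'e) pre_digraph \<Rightarrow> ('g \<Rightarrow> 'v \<Rightarrow> 'v)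
    \<Rightarrow> ('v \<Rightarrow> nat) \<Rightarrow> ('v \<Rightarrow> nat) \<Rightarrow> bool" where
  "precsim \<Gamma> E \<alpha> f f' \<longleftrightarrow>
     (\<exists>(n::nat) f1 f2 f3. \<exists>f'' \<in> Cc E.
        (\<forall>i \<in> {1..n}. f1 i \<in> Cc E \<and> f2 i \<in> Cc E \<and> f3 i \<in> Cc E
            \<and> sim_Gamma \<Gamma> E \<alpha> (f1 i) (f2 i) \<and> sim_Theta E (f2 i) (f3 i))
      \<and> sim_Theta E f (\<lambda>v. \<Sum>i=1..n. f1 i v)
      \<and> (\<forall>v. (\<Sum>i=1..n. f3 i v) \<le> f'' v)
      \<and> sim_Theta E f'' f')"

definition sim_rel ::
  "('g, 'm) monoid_scheme \<Rightarrow> ('v, 'e) pre_digraph \<Rightarrow> ('g \<Rightarrow> 'v \<Rightarrow> 'v) \<Rightarrow> ('v \<Rightarrow> nat) rel" where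
  "sim_rel \<Gamma> E \<alpha> = {(f, f'). f \<in> Cc E \<and> f' \<in> Cc E \<and> sim \<Gamma> E \<alpha> f f'}"

definition approx_rel ::
  "('g, 'm) monoid_scheme \<Rightarrow> ('v, 'e) pre_digraph \<Rightarrow> ('g \<Rightarrow> 'v \<Rightarrow> 'v) \<Rightarrow> ('v \<Rightarrow> nat) rel" where
  "approx_rel \<Gamma> E \<alpha> =
     {(f, f'). f \<in> Cc E \<and> f' \<in> Cc E \<and> precsim \<Gamma> E \<alpha> f f' \<and> precsim \<Gamma> E \<alpha> f' f}"

section \<open>Preordered monoids\<close>

text \<open>
  The monoids are commutative and written additively on paper; in the notation of HOL-Algebra
  \<open>x + y\<close> becomes \<open>x \<otimes> y\<close> and \<open>n x\<close> becomes \<open>x [^] n\<close>.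
\<close>

record 'a preordered_monoid = "'a monoid" +
  leq :: "'a \<Rightarrow> 'a \<Rightarrow> bool"

locale preordered_monoid = comm_monoid M
  for M :: "('a, 'm) preordered_monoid_scheme" (structure) +
  assumes leq_refl: "x \<in> carrier M \<Longrightarrow> leq M x x"
    and leq_trans: "\<lbrakk>x \<in> carrier M; y \<in> carrier M; z \<in> carrier M; leq M x y; leq M y z\<rbrakk>
      \<Longrightarrow> leq M x z"
    and leq_mult: "\<lbrakk>x \<in> carrier M; y \<in> carrier M; z \<in> carrier M; leq M x y\<rbrakk>
      \<Longrightarrow> leq M (x \<otimes>\<^bsub>M\<^esub> z) (y \<otimes>\<^bsub>M\<^esub> z)"

definition preordered_monoid_iso ::
  "('a, 'm) preordered_monoid_scheme \<Rightarrow> ('b, 'n) preordered_monoid_scheme \<Rightarrow> ('a \<Rightarrow> 'b) set" where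
  "preordered_monoid_iso M N =
     {h \<in> iso M N. \<forall>x \<in> carrier M. \<forall>y \<in> carrier M. leq M x y \<longleftrightarrow> leq N (h x) (h y)}"

definition unperforated :: "('a, 'm) preordered_monoid_scheme \<Rightarrow> bool" where
  "unperforated M \<longleftrightarrow>
     (\<forall>x \<in> carrier M. \<forall>y \<in> carrier M. \<forall>n::nat.
        n \<ge> 1 \<longrightarrow> leq M (x [^]\<^bsub>M\<^esub> n) (y [^]\<^bsub>M\<^esub> n) \<longrightarrow> leq M x y)"

definition class_add :: "('v \<Rightarrow> nat) rel \<Rightarrow> ('v \<Rightarrow> nat) set \<Rightarrow> ('v \<Rightarrow> nat) set \<Rightarrow> ('v \<Rightarrow> nat) set" where
  "class_add R X Y = (\<Union>f\<in>X. \<Union>f'\<in>Y. R `` {\<lambda>v. f v + f' v})"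

definition W_monoid ::
  "('g, 'm) monoid_scheme \<Rightarrow> ('v, 'e) pre_digraph \<Rightarrow> ('g \<Rightarrow> 'v \<Rightarrow> 'v)
    \<Rightarrow> ('v \<Rightarrow> nat) set preordered_monoid" where
  "W_monoid \<Gamma> E \<alpha> =
     \<lparr>carrier = Cc E // approx_rel \<Gamma> E \<alpha>,
      monoid.mult = class_add (approx_rel \<Gamma> E \<alpha>),
      one = approx_rel \<Gamma> E \<alpha> `` {\<lambda>_. 0},
      leq = (\<lambda>X Y. \<exists>f\<in>X. \<exists>f'\<in>Y. precsim \<Gamma> E \<alpha> f f')\<rparr>"

definition V_monoid ::
  "('g, 'm) monoid_scheme \<Rightarrow> ('v, 'e) pre_digraph \<Rightarrow> ('g \<Rightarrow> 'v \<Rightarrow> 'v)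
    \<Rightarrow> ('v \<Rightarrow> nat) set preordered_monoid" where
  "V_monoid \<Gamma> E \<alpha> =
     \<lparr>carrier = Cc E // sim_rel \<Gamma> E \<alpha>,
      monoid.mult = class_add (sim_rel \<Gamma> E \<alpha>),
      one = sim_rel \<Gamma> E \<alpha> `` {\<lambda>_. 0},
      leq = (\<lambda>X Y. \<exists>Z \<in> Cc E // sim_rel \<Gamma> E \<alpha>. class_add (sim_rel \<Gamma> E \<alpha>) X Z = Y)\<rparr>"

definition W_class ::
  "('g, 'm) monoid_scheme \<Rightarrow> ('v, 'e) pre_digraph \<Rightarrow> ('g \<Rightarrow> 'v \<Rightarrow> 'v)
    \<Rightarrow> ('v \<Rightarrow> nat) \<Rightarrow> ('v \<Rightarrow> nat) set" where
  "W_class \<Gamma> E \<alpha> f = approx_rel \<Gamma> E \<alpha> `` {f}"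

definition V_class ::
  "('g, 'm) monoid_scheme \<Rightarrow> ('v, 'e) pre_digraph \<Rightarrow> ('g \<Rightarrow> 'v \<Rightarrow> 'v)
    \<Rightarrow> ('v \<Rightarrow> nat) \<Rightarrow> ('v \<Rightarrow> nat) set" where
  "V_class \<Gamma> E \<alpha> f = sim_rel \<Gamma> E \<alpha> `` {f}"

text \<open>Graph monoids are the case of the trivial group. Group actions in HOL-Algebra are by extensional maps.\<close>

abbreviation trivial_group1 :: "unit monoid" where
  "trivial_group1 \<equiv> singleton_group ()"

definition trivial_action :: "('v, 'e) pre_digraph \<Rightarrow> unit \<Rightarrow> 'v \<Rightarrow> 'v" where
  "trivial_action E = (\<lambda>_. \<lambda>v \<in> verts E. v)"

abbreviation W_graph :: "('v, 'e) pre_digraph \<Rightarrow> ('v \<Rightarrow> nat) set preordered_monoid" where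
  "W_graph E \<equiv> W_monoid trivial_group1 E (trivial_action E)"

abbreviation V_graph :: "('v, 'e) pre_digraph \<Rightarrow> ('v \<Rightarrow> nat) set preordered_monoid" where
  "V_graph E \<equiv> V_monoid trivial_group1 E (trivial_action E)"

abbreviation W_graph_class :: "('v, 'e) pre_digraph \<Rightarrow> ('v \<Rightarrow> nat) \<Rightarrow> ('v \<Rightarrow> nat) set" where
  "W_graph_class E \<equiv> W_class trivial_group1 E (trivial_action E)"

abbreviation V_graph_class :: "('v, 'e) pre_digraph \<Rightarrow> ('v \<Rightarrow> nat) \<Rightarrow> ('v \<Rightarrow> nat) set" where
  "V_graph_class E \<equiv> V_class trivial_group1 E (trivial_action E)"

end

theory Submission
  imports Defs "HOL-Library.Multiset" "HOL-Library.Confluence"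
begin

text \<open>
  A finitely supported function on the vertices is a finite multiset of vertices, and \<open>\<Theta>\<close> replaces
  every vertex \<open>v\<close> by the sum of \<open>s(e)\<close> over \<open>e \<in> r\<^sup>-\<^sup>1(v)\<close>. Hence the monoids of the statement are
  best seen through multiset rewriting: one step replaces a single occurrence of \<open>v\<close> by this sum, and
  the graph monoid is the quotient by the congruence that the steps generate.

  Let \<open>\<pi>\<close> send a vertex to its orbit. As \<open>\<Gamma>\<close> acts by graph automorphisms, \<open>\<pi>\<close>
  carries the rewriting rules of \<open>E\<close> to those of \<open>E\<^sub>\<Gamma>\<close>. Therefore \<open>f \<sim> f'\<close> makes \<open>\<pi> f\<close> and \<open>\<pi> f'\<close>
  congruent over \<open>E\<^sub>\<Gamma>\<close>. For the converse, rewriting is confluent, so \<open>\<pi> f\<close> and \<open>\<pi> f'\<close> have a common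
  reduct, and both reductions lift along \<open>\<pi>\<close> to reductions \<open>f \<rightarrow> F\<close> and \<open>f' \<rightarrow> F'\<close> over \<open>E\<close> with
  \<open>\<pi> F = \<pi> F'\<close>. In a reduction different occurrences are replaced different numbers of times; bringing
  all of them to a common depth \<open>p\<close> writes \<open>\<Theta>\<^sup>p f\<close> as a sum of terms \<open>\<Theta>\<^sup>a 1\<^sub>w\<close>, one for each
  occurrence of a vertex \<open>w\<close> in \<open>F\<close>. Matching the occurrences in \<open>F\<close> with those in \<open>F'\<close> that lie in the
  same orbit gives exactly the decomposition that \<open>f \<sim> f'\<close> asks for (\<open>sim_iff_cong\<close>). The same
  argument with some occurrences in \<open>F'\<close> left unmatched shows that \<open>f \<precsim> f'\<close> is the algebraic preorder
  between the images (\<open>precsim_iff_le\<close>). So \<open>W(\<Gamma>,E)\<close> and \<open>V(\<Gamma>,E)\<close> are determined by the rewriting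
  system of \<open>E\<^sub>\<Gamma>\<close>. The same description holds for the trivial group acting on \<open>E\<^sub>\<Gamma>\<close>, with \<open>\<pi>\<close> the
  identity, and this yields the isomorphisms. It is also the reason why the relations are transitive and
  additive, which their definitions do not make evident.

  For unperforation, both orders are the algebraic preorder of a graph monoid, so it is enough that
  \<open>n a \<le> n b\<close> implies \<open>a \<le> b\<close> there (\<open>graph_le_unperforated\<close>). A given inequality uses finitely many
  of the relations \<open>x = d x\<close>. If \<open>x\<close> does not occur in \<open>d x\<close>, the generator \<open>x\<close> can be eliminated by
  substituting \<open>d x\<close> for it everywhere, which leaves a presentation of the same kind with one relation
  less. When no elimination is possible, every rule has the form \<open>x \<rightarrow> x + \<dots>\<close>. Then multisets only grow
  under rewriting, so \<open>n a \<le> n b\<close> means that \<open>n a\<close> is contained in a reduct \<open>c\<close> of \<open>n b\<close>; and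
  performing each step of \<open>n b \<rightarrow> c\<close> on a single copy of \<open>b\<close> gives a reduct \<open>c'\<close> of \<open>b\<close> with
  \<open>c \<subseteq> n c'\<close>, hence \<open>a \<subseteq> c'\<close> and \<open>a \<le> b\<close>.
\<close>

section \<open>Graph monoids as multiset rewriting\<close>

inductive graph_step :: "'x set \<Rightarrow> ('x \<Rightarrow> 'x multiset) \<Rightarrow> 'x multiset \<Rightarrow> 'x multiset \<Rightarrow> bool"
  for R d where
  "x \<in> R \<Longrightarrow> graph_step R d (add_mset x A) (A + d x)"

abbreviation graph_steps :: "'x set \<Rightarrow> ('x \<Rightarrow> 'x multiset) \<Rightarrow> 'x multiset \<Rightarrow> 'x multiset \<Rightarrow> bool" where
  "graph_steps R d \<equiv> (graph_step R d)\<^sup>*\<^sup>*"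

abbreviation graph_cong :: "'x set \<Rightarrow> ('x \<Rightarrow> 'x multiset) \<Rightarrow> 'x multiset \<Rightarrow> 'x multiset \<Rightarrow> bool" where
  "graph_cong R d \<equiv> equivclp (graph_step R d)"

text \<open>
  The algebraic preorder of the quotient monoid, pulled back to multisets. If \<open>d\<close> maps
  \<open>R\<close> to multisets on \<open>R\<close> and \<open>B\<close> is supported in \<open>R\<close>, then so is \<open>Z\<close>, by \<open>graph_cong_support\<close>.
\<close>

definition graph_le :: "'x set \<Rightarrow> ('x \<Rightarrow> 'x multiset) \<Rightarrow> 'x multiset \<Rightarrow> 'x multiset \<Rightarrow> bool" where
  "graph_le R d A B \<longleftrightarrow> (\<exists>Z. graph_cong R d (A + Z) B)"

lemma graph_step_add: "graph_step R d A B \<Longrightarrow> graph_step R d (A + C) (B + C)"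
proof (induction rule: graph_step.induct)
  case (1 x A)
  then show ?case
    using graph_step.intros[of x R d "A + C"] by (simp add: ac_simps)
qed

lemma graph_steps_imp_cong: "graph_steps R d A B \<Longrightarrow> graph_cong R d A B"
  by (rule predicate2D[OF rtranlcp_le_equivclp])

lemma graph_step_imp_cong: "graph_step R d A B \<Longrightarrow> graph_cong R d A B"
  by (simp add: graph_steps_imp_cong r_into_rtranclp)

lemma graph_cong_trans [trans]:
  "graph_cong R d A B \<Longrightarrow> graph_cong R d B C \<Longrightarrow> graph_cong R d A C"
  by (meson transpD transp_equivclp)

lemma graph_cong_refl [simp]: "graph_cong R d A A"
  by (meson reflpD reflp_equivclp)

lemma graph_cong_add_right: "graph_cong R d A B \<Longrightarrow> graph_cong R d (A + C) (B + C)"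
proof (induction rule: equivclp_induct)
  case (step Y Z)
  then show ?case
    by (meson graph_cong_trans graph_step_add graph_step_imp_cong equivclp_sym)
qed simp

lemma graph_cong_add:
  assumes "graph_cong R d A B" and "graph_cong R d C D"
  shows "graph_cong R d (A + C) (B + D)"
  using graph_cong_add_right[OF assms(1), of C] graph_cong_add_right[OF assms(2), of B]
  by (simp add: add.commute graph_cong_trans)

text \<open>
  Two rewrite steps either replace the same occurrence of a vertex, and then agree, or replace
  different occurrences, and then commute.
\<close>

lemma graph_step_confluent: "confluentp (graph_step R d)"
proof (intro strong_confluentp_imp_confluentp strong_confluentpI)
  fix M N N' assume "graph_step R d M N" "graph_step R d M N'"
  then obtain x A y B
    where x: "x \<in> R" "M = add_mset x A" "N = A + d x" and y: "y \<in> R" "M = add_mset y B" "N' = B + d y"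
    by (blast elim: graph_step.cases)
  show "\<exists>u. graph_steps R d N u \<and> (graph_step R d)\<^sup>=\<^sup>= N' u"
  proof (cases "x = y")
    case True
    then show ?thesis using x y by auto
  next
    case False
    with x y obtain C where "A = add_mset y C" "B = add_mset x C"
      by (metis add_eq_conv_ex)
    then have "graph_step R d N (C + d x + d y)" "graph_step R d N' (C + d x + d y)"
      using x y graph_step.intros[of y R d "C + d x"] graph_step.intros[of x R d "C + d y"]
      by (simp_all add: ac_simps)
    then show ?thesis by blast
  qed
qed

lemma graph_cong_common_reduct:
  assumes "graph_cong R d A B"
  obtains C where "graph_steps R d A C" and "graph_steps R d B C"
proof -
  have "graph_cong R d = graph_steps R d OO (graph_step R d)\<inverse>\<inverse>\<^sup>*\<^sup>*"
    using graph_step_confluent confluentp_imp_semiconfluentp semiconfluentp_equivclp by blast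
  then show ?thesis
    using assms that by (auto simp: rtranclp_conversep)
qed

text \<open>
  Each step acts on a single occurrence, which descends either from \<open>A\<close> or from \<open>B\<close>.
\<close>

lemma graph_steps_split:
  assumes "graph_steps R d (A + B) C"
  shows "\<exists>C1 C2. C = C1 + C2 \<and> graph_steps R d A C1 \<and> graph_steps R d B C2"
  using assms
proof (induction rule: rtranclp_induct)
  case base
  then show ?case by blast
next
  case (step Y Z)
  then obtain C1 C2 where C: "Y = C1 + C2" "graph_steps R d A C1" "graph_steps R d B C2"
    by blast
  from step(2) obtain x D where x: "x \<in> R" "Y = add_mset x D" "Z = D + d x"
    by (auto elim: graph_step.cases)
  then have "x \<in># C1 \<or> x \<in># C2"
    using C(1) by (metis union_iff union_single_eq_member)
  then show ?case
  proof
    assume "x \<in># C1"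
    then obtain C1' where C1': "C1 = add_mset x C1'" by (metis mset_add)
    then have "Z = (C1' + d x) + C2" using x C(1) by (simp add: ac_simps)
    moreover have "graph_steps R d A (C1' + d x)"
      using C(2) C1' graph_step.intros[OF x(1)] by (metis rtranclp.rtrancl_into_rtrancl)
    ultimately show ?thesis using C(3) by blast
  next
    assume "x \<in># C2"
    then obtain C2' where C2': "C2 = add_mset x C2'" by (metis mset_add)
    then have "Z = C1 + (C2' + d x)" using x C(1) by (simp add: ac_simps)
    moreover have "graph_steps R d B (C2' + d x)"
      using C(3) C2' graph_step.intros[OF x(1)] by (metis rtranclp.rtrancl_into_rtrancl)
    ultimately show ?thesis using C(2) by blast
  qed
qed

lemma graph_steps_empty: "graph_steps R d {#} C \<Longrightarrow> C = {#}"
  by (induction rule: rtranclp_induct) (auto elim: graph_step.cases)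

lemma graph_cong_sum_mset: "set_mset M \<subseteq> R \<Longrightarrow> graph_cong R d M (\<Sum>x\<in>#M. d x)"
proof (induction M)
  case (add x M)
  then have "graph_cong R d {#x#} (d x)"
    using graph_step.intros[of x R d "{#}"] by (simp add: graph_step_imp_cong)
  with add show ?case
    using graph_cong_add[of R d "{#x#}"] by simp
qed simp

lemma graph_cong_sum:
  "(\<And>i. i \<in> I \<Longrightarrow> graph_cong R d (A i) (B i)) \<Longrightarrow> graph_cong R d (sum A I) (sum B I)"
  by (induction I rule: infinite_finite_induct) (auto intro: graph_cong_add)

lemma graph_step_mono: "graph_step R d A B \<Longrightarrow> R \<subseteq> S \<Longrightarrow> graph_step S d A B"
  by (auto elim!: graph_step.cases intro: graph_step.intros)

lemma graph_cong_mono: "graph_cong R d A B \<Longrightarrow> R \<subseteq> S \<Longrightarrow> graph_cong S d A B"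
proof (induction rule: equivclp_induct)
  case (step Y Z)
  then show ?case
    by (meson graph_step_mono graph_cong_trans graph_step_imp_cong equivclp_sym)
qed simp

text \<open>
  A chain of steps mentions finitely many rules. This makes induction on the number of rules
  available for graphs with infinitely many vertices.
\<close>

lemma graph_cong_finite:
  assumes "graph_cong R d A B"
  obtains S where "S \<subseteq> R" "finite S" "graph_cong S d A B"
proof -
  have "\<exists>S \<subseteq> R. finite S \<and> graph_cong S d A B"
    using assms
  proof (induction rule: equivclp_induct)
    case base
    then show ?case by (intro exI[of _ "{}"]) auto
  next
    case (step Y Z)
    then obtain S where S: "S \<subseteq> R" "finite S" "graph_cong S d A Y" by blast
    have "\<exists>x\<in>R. graph_cong {x} d Y Z" if "graph_step R d Y Z" for Y Z
      using that by cases (auto intro!: graph_step_imp_cong graph_step.intros)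
    then obtain x where x: "x \<in> R" "graph_cong {x} d Y Z"
      using step(2) equivclp_sym by metis
    have "graph_cong (insert x S) d A Z"
      using graph_cong_trans graph_cong_mono[OF S(3)] graph_cong_mono[OF x(2)]
      by (metis insert_mono empty_subsetI subset_insertI)
    then show ?case using S x by (intro exI[of _ "insert x S"]) auto
  qed
  then show ?thesis using that by blast
qed

lemma graph_le_refl: "graph_le R d A A"
  unfolding graph_le_def by (rule exI[of _ "{#}"]) simp

lemma graph_le_trans:
  assumes "graph_le R d A B" and "graph_le R d B C"
  shows "graph_le R d A C"
proof -
  from assms obtain Y Z where "graph_cong R d (A + Y) B" "graph_cong R d (B + Z) C"
    by (auto simp: graph_le_def)
  then have "graph_cong R d (A + (Y + Z)) C"
    using graph_cong_add_right[of R d "A + Y" B Z] graph_cong_trans by (metis add.assoc)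
  then show ?thesis by (auto simp: graph_le_def)
qed

lemma graph_le_add_right:
  assumes "graph_le R d A B"
  shows "graph_le R d (A + C) (B + C)"
proof -
  from assms obtain Z where "graph_cong R d (A + Z) B" by (auto simp: graph_le_def)
  then have "graph_cong R d (A + C + Z) (B + C)"
    using graph_cong_add_right by (metis add.assoc add.commute)
  then show ?thesis by (auto simp: graph_le_def)
qed

lemma graph_le_add:
  assumes "graph_le R d A B" and "graph_le R d C D"
  shows "graph_le R d (A + C) (B + D)"
  using graph_le_trans[OF graph_le_add_right[OF assms(1), of C] graph_le_add_right[OF assms(2), of B,
    unfolded add.commute[of _ B]]] .

lemma graph_cong_support:
  assumes "graph_cong R d A B" and "\<And>x. x \<in> R \<Longrightarrow> set_mset (d x) \<subseteq> R"
  shows "set_mset A \<subseteq> R \<longleftrightarrow> set_mset B \<subseteq> R"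
  using assms(1)
proof (induction rule: equivclp_induct)
  case (step Y Z)
  have "set_mset Y \<subseteq> R \<longleftrightarrow> set_mset Z \<subseteq> R" if "graph_step R d Y Z" for Y Z
    using that assms(2) by cases auto
  with step show ?case by blast
qed simp

section \<open>Graph monoids are unperforated\<close>

lemma graph_steps_grow:
  assumes "graph_steps R d A B" and "\<And>x. x \<in> R \<Longrightarrow> x \<in># d x"
  shows "A \<subseteq># B"
  using assms(1)
proof (induction rule: rtranclp_induct)
  case (step Y Z)
  then obtain x D where "x \<in> R" "Y = add_mset x D" "Z = D + d x"
    by (auto elim: graph_step.cases)
  then have "Y \<subseteq># Z"
    using assms(2)[of x] by (auto dest!: multi_member_split)
  with step show ?case by auto
qed simp

text \<open>
  Along the reduction \<open>Y \<subseteq># n C'\<close> is maintained for reducts \<open>Y\<close> of \<open>n B\<close> and \<open>C'\<close> of \<open>B\<close>. A vertex \<open>x\<close>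
  that the next step replaces in \<open>Y\<close> occurs in \<open>C'\<close>, so that the step can be imitated there. As \<open>d x\<close>
  contains \<open>x\<close>, the step adds \<open>d x - x\<close> to \<open>Y\<close> once and to \<open>n C'\<close> at least once.
\<close>

lemma graph_steps_repeat_mset:
  assumes "graph_steps R d (repeat_mset n B) C" and "\<And>x. x \<in> R \<Longrightarrow> x \<in># d x" and "n \<ge> 1"
  shows "\<exists>C'. graph_steps R d B C' \<and> C \<subseteq># repeat_mset n C'"
  using assms(1)
proof (induction rule: rtranclp_induct)
  case base
  then show ?case by blast
next
  case (step Y Z)
  then obtain C' where C': "graph_steps R d B C'" "Y \<subseteq># repeat_mset n C'" by blast
  from step(2) obtain x D where x: "x \<in> R" "Y = add_mset x D" "Z = D + d x"
    by (auto elim: graph_step.cases)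
  from assms(2)[OF x(1)] obtain e where e: "d x = add_mset x e" by (metis mset_add)
  have "x \<in># repeat_mset n C'"
    using C'(2) x(2) by (metis mset_subset_eqD union_single_eq_member)
  then have "x \<in># C'"
    by (metis count_eq_zero_iff count_repeat_mset mult_0_right)
  then obtain C0 where C0: "C' = add_mset x C0" by (metis mset_add)
  have "graph_step R d C' (C' + e)"
    using graph_step.intros[OF x(1), of d C0] C0 e by simp
  then have "graph_steps R d B (C' + e)" using C'(1) by simp
  moreover have "Z \<subseteq># repeat_mset n (C' + e)"
  proof -
    have "Z = Y + e" using x e by simp
    moreover have "e \<subseteq># repeat_mset n e"
      using assms(3) by (auto simp: subseteq_mset_def)
    ultimately show ?thesis using C'(2) by (simp add: subset_mset.add_mono)
  qed
  ultimately show ?case by blast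
qed

text \<open>
  Induction on the number of rules: rules that reproduce their own left-hand side need no
  elimination, and any other rule can be eliminated by substitution.
\<close>

lemma graph_le_unperforated_finite:
  assumes "finite R" and "n \<ge> 1" and "graph_le R d (repeat_mset n A) (repeat_mset n B)"
  shows "graph_le R d A B"
  using assms(1,3)
proof (induction R arbitrary: d A B rule: measure_induct_rule[of card])
  case (less R)
  show ?case
  proof (cases "\<forall>x\<in>R. x \<in># d x")
    case True
    then have grow: "x \<in># d x" if "x \<in> R" for x using that by blast
    from less.prems obtain Z where "graph_cong R d (repeat_mset n A + Z) (repeat_mset n B)"
      by (auto simp: graph_le_def)
    then obtain C
      where C: "graph_steps R d (repeat_mset n A + Z) C" "graph_steps R d (repeat_mset n B) C"
      by (rule graph_cong_common_reduct)
    obtain C' where C': "graph_steps R d B C'" "C \<subseteq># repeat_mset n C'"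
      using graph_steps_repeat_mset[OF C(2) grow \<open>n \<ge> 1\<close>] by blast
    have "repeat_mset n A \<subseteq># repeat_mset n C'"
      using graph_steps_grow[OF C(1) grow] C'(2)
      by (meson mset_subset_eq_add_left subset_mset.order_trans)
    then have "A \<subseteq># C'"
      using \<open>n \<ge> 1\<close> by (simp add: subseteq_mset_def)
    then obtain Z' where "C' = A + Z'" by (auto simp: subset_mset.le_iff_add)
    then show ?thesis
      using C'(1) by (metis equivclp_sym graph_le_def graph_steps_imp_cong)
  next
    case False
    then obtain x where x: "x \<in> R" "x \<notin># d x" by blast
    \<comment> \<open>\<open>\<phi>\<close> substitutes \<open>d x\<close> for \<open>x\<close>; the remaining relations then become the rules \<open>?d\<close> on \<open>?S\<close>\<close>
    define e where "e y = (if y = x then d x else {#y#})" for y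
    define \<phi> where "\<phi> M = (\<Sum>y\<in>#M. e y)" for M
    have \<phi>_add [simp]: "\<phi> (M + N) = \<phi> M + \<phi> N" "\<phi> (add_mset y M) = e y + \<phi> M" for M N y
      by (simp_all add: \<phi>_def)
    have \<phi>_id: "\<phi> M = M" if "x \<notin># M" for M
      using that by (induction M) (auto simp: \<phi>_def e_def)
    have \<phi>_repeat: "\<phi> (repeat_mset n M) = repeat_mset n (\<phi> M)" for n M
      by (induction n) (auto simp: \<phi>_def)
    let ?S = "R - {x}" and ?d = "\<lambda>y. \<phi> (d y)"
    have cong_\<phi>: "graph_cong R d M (\<phi> M)" for M
    proof (induction M)
      case (add y M)
      have "graph_cong R d {#y#} (e y)"
        using graph_step_imp_cong[OF graph_step.intros[OF x(1), of d "{#}"]] by (auto simp: e_def)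
      then show ?case
        using graph_cong_add[OF _ add] by fastforce
    qed (simp add: \<phi>_def)
    have to: "graph_cong ?S ?d (\<phi> M) (\<phi> N)" if "graph_cong R d M N" for M N
      using that
    proof (induction rule: equivclp_induct)
      case (step Y Z)
      have "graph_cong ?S ?d (\<phi> Y) (\<phi> Z)" if "graph_step R d Y Z" for Y Z
        using that
      proof cases
        case (1 y D)
        show ?thesis
        proof (cases "y = x")
          case True
          then show ?thesis using 1 \<phi>_id[OF x(2)] by (simp add: e_def ac_simps)
        next
          case False
          then have "graph_step ?S ?d (add_mset y (\<phi> D)) (\<phi> D + \<phi> (d y))"
            using 1 by (intro graph_step.intros) auto
          then show ?thesis
            using 1 False by (simp add: e_def graph_step_imp_cong)
        qed
      qed
      then show ?case using step by (meson graph_cong_trans equivclp_sym)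
    qed simp
    have from': "graph_cong R d M N" if "graph_cong ?S ?d M N" for M N
      using that
    proof (induction rule: equivclp_induct)
      case (step Y Z)
      have "graph_cong R d Y Z" if "graph_step ?S ?d Y Z" for Y Z
        using that
      proof cases
        case (1 y D)
        then have "graph_cong R d Y (D + d y)"
          by (simp add: graph_step.intros graph_step_imp_cong)
        also have "graph_cong R d (D + d y) Z"
          using 1 graph_cong_add[OF graph_cong_refl cong_\<phi>] by simp
        finally show ?thesis .
      qed
      then show ?case using step by (meson graph_cong_trans equivclp_sym)
    qed simp
    from less.prems obtain Z where "graph_cong R d (repeat_mset n A + Z) (repeat_mset n B)"
      by (auto simp: graph_le_def)
    from to[OF this] have "graph_le ?S ?d (repeat_mset n (\<phi> A)) (repeat_mset n (\<phi> B))"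
      by (auto simp: \<phi>_repeat graph_le_def)
    moreover have "card ?S < card R"
      using x(1) less.prems(1) by (intro card_Diff1_less)
    ultimately have "graph_le ?S ?d (\<phi> A) (\<phi> B)"
      using less.IH less.prems(1) by simp
    then obtain Z' where "graph_cong R d (\<phi> A + Z') (\<phi> B)"
      using from' by (auto simp: graph_le_def)
    then have "graph_cong R d (A + Z') B"
      using cong_\<phi> graph_cong_add_right graph_cong_trans equivclp_sym by metis
    then show ?thesis by (auto simp: graph_le_def)
  qed
qed

theorem graph_le_unperforated:
  assumes "n \<ge> 1" and "graph_le R d (repeat_mset n A) (repeat_mset n B)"
  shows "graph_le R d A B"
proof -
  from assms(2) obtain Z where "graph_cong R d (repeat_mset n A + Z) (repeat_mset n B)"
    by (auto simp: graph_le_def)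
  then obtain S where S: "S \<subseteq> R" "finite S" "graph_cong S d (repeat_mset n A + Z) (repeat_mset n B)"
    by (rule graph_cong_finite)
  then have "graph_le S d A B"
    using graph_le_unperforated_finite[OF S(2) assms(1)] graph_le_def by metis
  then show ?thesis
    using graph_cong_mono[OF _ S(1)] by (auto simp: graph_le_def)
qed

section \<open>Counting paths\<close>

definition in_nbrs :: "('v, 'e) pre_digraph \<Rightarrow> 'v \<Rightarrow> 'v multiset" where
  "in_nbrs E v = image_mset (tail E) (mset_set (in_arcs E v))"

definition theta :: "('v, 'e) pre_digraph \<Rightarrow> 'v multiset \<Rightarrow> 'v multiset" where
  "theta E M = (\<Sum>v\<in>#M. in_nbrs E v)"

abbreviation thetas :: "('v, 'e) pre_digraph \<Rightarrow> nat \<Rightarrow> 'v multiset \<Rightarrow> 'v multiset" where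
  "thetas E n \<equiv> theta E ^^ n"

lemma theta_simps [simp]:
  "theta E {#} = {#}" "theta E (add_mset v M) = in_nbrs E v + theta E M"
  "theta E (M + N) = theta E M + theta E N"
  by (simp_all add: theta_def)

lemma thetas_plus [simp]: "thetas E n (M + N) = thetas E n M + thetas E n N"
  and thetas_empty [simp]: "thetas E n {#} = {#}"
  by (induction n) simp_all

lemma thetas_sum_mset: "thetas E n (\<Sum>x\<in>#M. f x) = (\<Sum>x\<in>#M. thetas E n (f x))"
  by (induction M) simp_all

lemma thetas_conv_singletons: "thetas E n M = (\<Sum>v\<in>#M. thetas E n {#v#})"
  using thetas_sum_mset[of n E "\<lambda>v. {#v#}" M] by simp

lemma count_sum_mset_image:
  "count (\<Sum>x\<in>#M. f x) a = (\<Sum>x\<in>set_mset M. count M x * count (f x) a)"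
proof -
  have "count (\<Sum>x\<in>#N. f x) a = (\<Sum>x\<in>set_mset M. count N x * count (f x) a)" if "N \<subseteq># M" for N
    using that
  proof (induction N)
    case (add y N)
    then have "y \<in># M" "N \<subseteq># M"
      by (auto dest: mset_subset_eq_insertD mset_subset_eqD)
    have "(\<Sum>x\<in>set_mset M. count (add_mset y N) x * count (f x) a)
        = (\<Sum>x\<in>set_mset M. (if x = y then count (f x) a else 0) + count N x * count (f x) a)"
      by (intro sum.cong) auto
    then show ?case
      using add.IH[OF \<open>N \<subseteq># M\<close>] \<open>y \<in># M\<close> by (simp add: sum.distrib)
  qed simp
  then show ?thesis by simp
qed

text \<open>
  A path is split at its first edge, the one at its range. The remaining path keeps its source,
  so the number of paths with given ends satisfies the same recursion as the powers of \<open>theta\<close>.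
\<close>

lemma paths_from_Suc:
  "{es \<in> paths_from E (Suc n) v. path_range E v es = w} =
     (\<Union>e\<in>in_arcs E w. Cons e ` {es \<in> paths_from E n v. path_range E v es = tail E e})"
proof (intro equalityI subsetI)
  fix es assume es: "es \<in> {es \<in> paths_from E (Suc n) v. path_range E v es = w}"
  then obtain e es' where e: "es = e # es'" "length es' = n"
    by (auto simp: paths_from_def length_Suc_conv)
  have consec: "tail E (es ! i) = head E (es ! Suc i)" if "i < n" for i
    using es that by (auto simp: paths_from_def)
  have "es' \<in> paths_from E n v"
    using es e consec[of "Suc _"] by (auto simp: paths_from_def)
  moreover have "path_range E v es' = tail E e"
    using es e consec[of 0] by (cases es') (auto simp: paths_from_def path_range_def)
  moreover have "e \<in> in_arcs E w"
    using es e by (auto simp: paths_from_def path_range_def)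
  ultimately show "es \<in> (\<Union>e\<in>in_arcs E w. Cons e `
      {es \<in> paths_from E n v. path_range E v es = tail E e})"
    using e by blast
next
  fix es assume "es \<in> (\<Union>e\<in>in_arcs E w. Cons e `
      {es \<in> paths_from E n v. path_range E v es = tail E e})"
  then obtain e es' where e: "es = e # es'" "e \<in> arcs E" "head E e = w"
    "es' \<in> paths_from E n v" "path_range E v es' = tail E e"
    by auto
  have "tail E (es ! i) = head E (es ! Suc i)" if "i < n" for i
  proof (cases i)
    case 0
    then show ?thesis
      using e that by (cases es') (auto simp: paths_from_def path_range_def)
  next
    case (Suc j)
    then show ?thesis using e that by (auto simp: paths_from_def)
  qed
  then show "es \<in> {es \<in> paths_from E (Suc n) v. path_range E v es = w}"
    using e by (auto simp: paths_from_def path_range_def split: if_splits)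
qed

context row_finite_no_sources
begin

lemma finite_card_paths:
  assumes "w \<in> verts E"
  shows "finite {es \<in> paths_from E n v. path_range E v es = w}
       \<and> card {es \<in> paths_from E n v. path_range E v es = w} = count (thetas E n {#w#}) v"
  using assms
proof (induction n arbitrary: w)
  case 0
  have "{es \<in> paths_from E 0 v. path_range E v es = w} = (if v = w then {[]} else {})"
    by (auto simp: paths_from_def path_range_def)
  then show ?case by simp
next
  case (Suc n)
  let ?P = "\<lambda>e. {es \<in> paths_from E n v. path_range E v es = tail E e}"
  have fin: "finite (in_arcs E w)" using Suc.prems finite_in_arcs by blast
  have IH: "finite (?P e)" "card (?P e) = count (thetas E n {#tail E e#}) v" if "e \<in> in_arcs E w" for e
    using Suc.IH[of "tail E e"] that by auto
  have "card (\<Union>e\<in>in_arcs E w. Cons e ` ?P e) = (\<Sum>e\<in>in_arcs E w. card (Cons e ` ?P e))"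
    using fin IH(1) by (intro card_UN_disjoint) auto
  also have "\<dots> = (\<Sum>e\<in>in_arcs E w. count (thetas E n {#tail E e#}) v)"
    using IH(2) by (intro sum.cong) (simp_all add: card_image)
  also have "\<dots> = count (thetas E n (in_nbrs E w)) v"
    by (subst thetas_conv_singletons)
      (simp add: in_nbrs_def count_sum[symmetric] sum_unfold_sum_mset image_mset.compositionality comp_def)
  also have "\<dots> = count (thetas E (Suc n) {#w#}) v"
    by (simp add: funpow_swap1)
  finally show ?case
    unfolding paths_from_Suc using fin IH(1) by simp
qed

text \<open>
  The index set of the sum that defines \<open>Theta\<close> may be infinite, but the paths with range in the
  support of \<open>M\<close> are finite in number, by row-finiteness.
\<close>

lemma Theta_count:
  assumes "set_mset M \<subseteq> verts E"
  shows "Theta E n (count M) = count (thetas E n M)"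
proof
  fix v
  let ?S = "\<lambda>w. {es \<in> paths_from E n v. path_range E v es = w}"
  have S: "finite (?S w)" "card (?S w) = count (thetas E n {#w#}) v" if "w \<in># M" for w
    using finite_card_paths[of w n v] that assms by auto
  have supp: "{es \<in> paths_from E n v. count M (path_range E v es) \<noteq> 0} = (\<Union>w\<in>set_mset M. ?S w)"
    by auto
  then have "finite {es \<in> paths_from E n v. count M (path_range E v es) \<noteq> 0}"
    using S(1) by simp
  then have "Theta E n (count M) v = (\<Sum>es\<in>(\<Union>w\<in>set_mset M. ?S w). count M (path_range E v es))"
    unfolding Theta_def sum.G_def by (simp only: supp if_True)
  also have "\<dots> = (\<Sum>w\<in>set_mset M. \<Sum>es\<in>?S w. count M (path_range E v es))"
    using S(1) by (intro sum.UNION_disjoint) auto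
  also have "\<dots> = (\<Sum>w\<in>set_mset M. count M w * count (thetas E n {#w#}) v)"
    using S(2) by (intro sum.cong) auto
  also have "\<dots> = count (thetas E n M) v"
    by (subst (2) thetas_conv_singletons) (simp add: count_sum_mset_image)
  finally show "Theta E n (count M) v = count (thetas E n M) v" .
qed

lemma set_in_nbrs: "set_mset (in_nbrs E v) \<subseteq> verts E"
  by (cases "finite (in_arcs E v)") (auto simp: in_nbrs_def)

lemma set_theta: "set_mset (theta E M) \<subseteq> verts E"
  using set_in_nbrs by (auto simp: theta_def)

lemma set_thetas: "set_mset M \<subseteq> verts E \<Longrightarrow> set_mset (thetas E n M) \<subseteq> verts E"
  by (cases n) (simp_all add: set_theta)

end

section \<open>The relations of an action as congruences of a graph monoid\<close>

lemma image_mset_sum: "image_mset h (sum A I) = (\<Sum>i\<in>I. image_mset h (A i))"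
  by (induction I rule: infinite_finite_induct) auto

lemma set_mset_sum_subset: "(\<And>i. i \<in> I \<Longrightarrow> set_mset (A i) \<subseteq> V) \<Longrightarrow> set_mset (sum A I) \<subseteq> V"
  by (induction I rule: infinite_finite_induct) auto

lemma Cc_iff: "f \<in> Cc E \<longleftrightarrow> (\<exists>F. f = count F \<and> set_mset F \<subseteq> verts E)"
proof
  assume f: "f \<in> Cc E"
  then have count: "count (Abs_multiset f) = f"
    by (simp add: Cc_def count_Abs_multiset)
  have "v \<in> verts E" if "v \<in># Abs_multiset f" for v
    using that f by (auto simp: Cc_def count simp flip: count_greater_zero_iff)
  then show "\<exists>F. f = count F \<and> set_mset F \<subseteq> verts E"
    using count by (intro exI[of _ "Abs_multiset f"]) auto
next
  assume "\<exists>F. f = count F \<and> set_mset F \<subseteq> verts E"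
  then obtain F where F: "f = count F" "set_mset F \<subseteq> verts E" by blast
  have "{v. f v \<noteq> 0} = set_mset F"
    using F(1) by (auto simp: count_eq_zero_iff)
  then show "f \<in> Cc E" using F(2) by (simp add: Cc_def)
qed

lemma count_Cc [simp]: "count F \<in> Cc E \<longleftrightarrow> set_mset F \<subseteq> verts E"
  by (auto simp: Cc_iff count_inject)

text \<open>
  The middle part that \<open>sim\<close> and \<open>precsim\<close> share: \<open>f\<close> is cut into summands, each of which is moved
  by a group element and then through \<open>sim_Theta\<close>.
\<close>

definition piecewise ::
  "('g, 'm) monoid_scheme \<Rightarrow> ('v, 'e) pre_digraph \<Rightarrow> ('g \<Rightarrow> 'v \<Rightarrow> 'v)
    \<Rightarrow> ('v \<Rightarrow> nat) \<Rightarrow> ('v \<Rightarrow> nat) \<Rightarrow> bool" where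
  "piecewise \<Gamma> E \<alpha> f f' \<longleftrightarrow>
     (\<exists>(n::nat) f1 f2 f3.
        (\<forall>i \<in> {1..n}. f1 i \<in> Cc E \<and> f2 i \<in> Cc E \<and> f3 i \<in> Cc E
            \<and> sim_Gamma \<Gamma> E \<alpha> (f1 i) (f2 i) \<and> sim_Theta E (f2 i) (f3 i))
      \<and> f = (\<lambda>v. \<Sum>i=1..n. f1 i v) \<and> f' = (\<lambda>v. \<Sum>i=1..n. f3 i v))"

lemma sim_iff_piecewise:
  "sim \<Gamma> E \<alpha> f f' \<longleftrightarrow>
     (\<exists>a b. sim_Theta E f a \<and> piecewise \<Gamma> E \<alpha> a b \<and> sim_Theta E b f')"
  unfolding sim_def piecewise_def by blast

lemma precsim_iff_piecewise:
  "precsim \<Gamma> E \<alpha> f f' \<longleftrightarrow>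
     (\<exists>a b. \<exists>f''\<in>Cc E. sim_Theta E f a \<and> piecewise \<Gamma> E \<alpha> a b \<and> b \<le> f'' \<and> sim_Theta E f'' f')"
  unfolding precsim_def piecewise_def le_fun_def by blast

lemma piecewise_zero: "piecewise \<Gamma> E \<alpha> (\<lambda>_. 0) (\<lambda>_. 0)"
  unfolding piecewise_def by (intro exI[of _ 0]) auto

lemma piecewise_add:
  assumes "piecewise \<Gamma> E \<alpha> f f'"
    and "a \<in> Cc E" "b \<in> Cc E" "c \<in> Cc E" "sim_Gamma \<Gamma> E \<alpha> a b" "sim_Theta E b c"
  shows "piecewise \<Gamma> E \<alpha> (\<lambda>v. f v + a v) (\<lambda>v. f' v + c v)"
proof -
  from assms(1) obtain n :: nat and f1 f2 f3
    where *: "\<forall>i \<in> {1..n}. f1 i \<in> Cc E \<and> f2 i \<in> Cc E \<and> f3 i \<in> Cc E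
            \<and> sim_Gamma \<Gamma> E \<alpha> (f1 i) (f2 i) \<and> sim_Theta E (f2 i) (f3 i)"
      "f = (\<lambda>v. \<Sum>i=1..n. f1 i v)" "f' = (\<lambda>v. \<Sum>i=1..n. f3 i v)"
    unfolding piecewise_def by blast
  let ?u = "\<lambda>f a. f(Suc n := a)"
  show ?thesis
    unfolding piecewise_def
  proof (rule exI[of _ "Suc n"], rule exI[of _ "?u f1 a"], rule exI[of _ "?u f2 b"],
      rule exI[of _ "?u f3 c"], intro conjI)
    show "\<forall>i \<in> {1..Suc n}. ?u f1 a i \<in> Cc E \<and> ?u f2 b i \<in> Cc E \<and> ?u f3 c i \<in> Cc E
            \<and> sim_Gamma \<Gamma> E \<alpha> (?u f1 a i) (?u f2 b i) \<and> sim_Theta E (?u f2 b i) (?u f3 c i)"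
      using *(1) assms(2-) by (auto simp: le_Suc_eq)
  qed (auto simp: *(2,3) fun_eq_iff intro!: sum.cong)
qed

text \<open>
  The fibres of \<open>\<pi>\<close> are the orbits, and \<open>d\<close> is the rewriting rule that \<open>\<pi>\<close> induces on its image.
  The map is kept abstract because the quotient graph enters twice: as the target of the orbit map of
  \<open>E\<close>, and as a graph in its own right, with the trivial action and the identity map. In both cases
  \<open>d\<close> is the rewriting rule of the quotient graph, and the results become comparable.
\<close>

locale orbit_map =
  row_finite_no_sources E
  for \<Gamma> :: "('g, 'm) monoid_scheme"
    and E :: "('v, 'e) pre_digraph"
    and \<alpha> :: "'g \<Rightarrow> 'v \<Rightarrow> 'v"
    and \<pi> :: "'v \<Rightarrow> 'x"
    and d :: "'x \<Rightarrow> 'x multiset" +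
  assumes action_bij: "g \<in> carrier \<Gamma> \<Longrightarrow> bij_betw (\<alpha> g) (verts E) (verts E)"
    and in_nbrs_action:
      "\<lbrakk>g \<in> carrier \<Gamma>; v \<in> verts E\<rbrakk> \<Longrightarrow> in_nbrs E (\<alpha> g v) = image_mset (\<alpha> g) (in_nbrs E v)"
    and same_image_iff:
      "\<lbrakk>u \<in> verts E; v \<in> verts E\<rbrakk> \<Longrightarrow> \<pi> u = \<pi> v \<longleftrightarrow> (\<exists>g\<in>carrier \<Gamma>. \<alpha> g u = v)"
    and in_nbrs_image: "v \<in> verts E \<Longrightarrow> d (\<pi> v) = image_mset \<pi> (in_nbrs E v)"
begin

abbreviation proj :: "'v multiset \<Rightarrow> 'x multiset" where
  "proj \<equiv> image_mset \<pi>"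

abbreviation orbit_cong :: "'x multiset \<Rightarrow> 'x multiset \<Rightarrow> bool" where
  "orbit_cong \<equiv> graph_cong (\<pi> ` verts E) d"

abbreviation orbit_le :: "'x multiset \<Rightarrow> 'x multiset \<Rightarrow> bool" where
  "orbit_le \<equiv> graph_le (\<pi> ` verts E) d"

lemma action_in_verts: "g \<in> carrier \<Gamma> \<Longrightarrow> v \<in> verts E \<Longrightarrow> \<alpha> g v \<in> verts E"
  using action_bij bij_betwE by blast

lemma proj_action:
  assumes "g \<in> carrier \<Gamma>" "set_mset F \<subseteq> verts E"
  shows "proj (image_mset (\<alpha> g) F) = proj F"
proof -
  have "\<pi> (\<alpha> g v) = \<pi> v" if "v \<in># F" for v
    using same_image_iff[of v "\<alpha> g v"] action_in_verts that assms by (metis subsetD)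
  then show ?thesis
    by (simp add: image_mset.compositionality comp_def cong: image_mset_cong)
qed

lemma count_action:
  assumes "g \<in> carrier \<Gamma>" "set_mset F \<subseteq> verts E" "v \<in> verts E"
  shows "count (image_mset (\<alpha> g) F) (\<alpha> g v) = count F v"
proof -
  have "inj_on (\<alpha> g) (verts E)" using action_bij assms(1) bij_betw_def by blast
  then have "{x. x \<in># F \<and> \<alpha> g v = \<alpha> g x} = (if v \<in># F then {v} else {})"
    using assms(2,3) by (auto dest: inj_onD)
  then show ?thesis by (auto simp: count_image_mset' count_eq_zero_iff)
qed

lemma sim_Gamma_iff:
  assumes "set_mset F \<subseteq> verts E" "set_mset G \<subseteq> verts E"
  shows "sim_Gamma \<Gamma> E \<alpha> (count F) (count G) \<longleftrightarrow> (\<exists>g\<in>carrier \<Gamma>. G = image_mset (\<alpha> g) F)"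
proof
  assume "sim_Gamma \<Gamma> E \<alpha> (count F) (count G)"
  then obtain g where g: "g \<in> carrier \<Gamma>" "\<And>v. v \<in> verts E \<Longrightarrow> count F v = count G (\<alpha> g v)"
    by (auto simp: sim_Gamma_def)
  have "count G w = count (image_mset (\<alpha> g) F) w" for w
  proof (cases "w \<in> verts E")
    case True
    then obtain v where "v \<in> verts E" "w = \<alpha> g v"
      using action_bij[OF g(1)] by (metis bij_betw_imp_surj_on imageE)
    then show ?thesis using g count_action assms(1) by simp
  next
    case False
    then have "w \<notin># G" "w \<notin># image_mset (\<alpha> g) F"
      using assms action_in_verts[OF g(1)] by auto
    then show ?thesis by (metis not_in_iff)
  qed
  then show "\<exists>g\<in>carrier \<Gamma>. G = image_mset (\<alpha> g) F"
    using g(1) by (blast intro: multiset_eqI)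
next
  assume "\<exists>g\<in>carrier \<Gamma>. G = image_mset (\<alpha> g) F"
  then show "sim_Gamma \<Gamma> E \<alpha> (count F) (count G)"
    using assms(1) unfolding sim_Gamma_def by (metis count_action)
qed

lemma thetas_action:
  assumes "g \<in> carrier \<Gamma>" "set_mset F \<subseteq> verts E"
  shows "thetas E n (image_mset (\<alpha> g) F) = image_mset (\<alpha> g) (thetas E n F)"
proof (induction n)
  case (Suc n)
  have "theta E (image_mset (\<alpha> g) G) = image_mset (\<alpha> g) (theta E G)" if "set_mset G \<subseteq> verts E" for G
    using that assms(1) by (induction G) (auto simp: in_nbrs_action)
  then show ?case using Suc set_thetas assms(2) by simp
qed simp

lemma orbit_cong_thetas:
  assumes "set_mset F \<subseteq> verts E"
  shows "orbit_cong (proj F) (proj (thetas E n F))"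
proof (induction n)
  case (Suc n)
  let ?G = "thetas E n F"
  have G: "set_mset ?G \<subseteq> verts E" by (rule set_thetas[OF assms])
  have "(\<Sum>x\<in>#proj H. d x) = proj (theta E H)" if "set_mset H \<subseteq> verts E" for H
    using that by (induction H) (auto simp: in_nbrs_image)
  with G have "(\<Sum>x\<in>#proj ?G. d x) = proj (theta E ?G)" by blast
  moreover have "orbit_cong (proj ?G) (\<Sum>x\<in>#proj ?G. d x)"
    using G by (intro graph_cong_sum_mset) auto
  ultimately show ?case using Suc graph_cong_trans by simp
qed simp

lemma sim_Theta_imp_cong:
  assumes "set_mset F \<subseteq> verts E" "set_mset G \<subseteq> verts E" "sim_Theta E (count F) (count G)"
  shows "orbit_cong (proj F) (proj G)"
proof -
  from assms obtain p q where "thetas E p F = thetas E q G"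
    by (auto simp: sim_Theta_def Theta_count count_inject)
  then show ?thesis
    using orbit_cong_thetas[OF assms(1), of p] orbit_cong_thetas[OF assms(2), of q]
    by (metis graph_cong_trans equivclp_sym)
qed

lemma piecewise_imp_cong:
  assumes "piecewise \<Gamma> E \<alpha> a b"
  obtains A B where "a = count A" "b = count B" "set_mset A \<subseteq> verts E" "set_mset B \<subseteq> verts E"
    "orbit_cong (proj A) (proj B)"
proof -
  from assms obtain n :: nat and f1 f2 f3
    where *: "\<And>i. i \<in> {1..n} \<Longrightarrow> f1 i \<in> Cc E \<and> f2 i \<in> Cc E \<and> f3 i \<in> Cc E
            \<and> sim_Gamma \<Gamma> E \<alpha> (f1 i) (f2 i) \<and> sim_Theta E (f2 i) (f3 i)"
      and a: "a = (\<lambda>v. \<Sum>i=1..n. f1 i v)" and b: "b = (\<lambda>v. \<Sum>i=1..n. f3 i v)"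
    unfolding piecewise_def by blast
  have "\<exists>A B. f1 i = count A \<and> f3 i = count B \<and> set_mset A \<subseteq> verts E \<and> set_mset B \<subseteq> verts E
      \<and> orbit_cong (proj A) (proj B)" if i: "i \<in> {1..n}" for i
  proof -
    obtain A G B where AGB: "f1 i = count A" "f2 i = count G" "f3 i = count B"
      "set_mset A \<subseteq> verts E" "set_mset G \<subseteq> verts E" "set_mset B \<subseteq> verts E"
      using *[OF i] by (auto simp: Cc_iff)
    then have "proj A = proj G"
      using *[OF i] sim_Gamma_iff[of A G] proj_action by auto
    then show ?thesis
      using AGB *[OF i] sim_Theta_imp_cong[of G B]
      by (intro exI[of _ A] exI[of _ B]) simp
  qed
  then obtain A B where AB: "\<And>i. i \<in> {1..n} \<Longrightarrow> f1 i = count (A i) \<and> f3 i = count (B i)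
      \<and> set_mset (A i) \<subseteq> verts E \<and> set_mset (B i) \<subseteq> verts E \<and> orbit_cong (proj (A i)) (proj (B i))"
    by metis
  show ?thesis
  proof (rule that)
    show "a = count (\<Sum>i=1..n. A i)" "b = count (\<Sum>i=1..n. B i)"
      using AB by (auto simp: a b fun_eq_iff count_sum)
    show "set_mset (\<Sum>i=1..n. A i) \<subseteq> verts E" "set_mset (\<Sum>i=1..n. B i) \<subseteq> verts E"
      using AB by (intro set_mset_sum_subset, blast)+
    show "orbit_cong (proj (\<Sum>i=1..n. A i)) (proj (\<Sum>i=1..n. B i))"
      unfolding image_mset_sum using AB by (intro graph_cong_sum) auto
  qed
qed

text \<open>
  A pair \<open>(w, a)\<close> stands for an occurrence of the vertex \<open>w\<close> that is still to be replaced \<open>a\<close>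
  times.
\<close>

abbreviation unravel :: "('v \<times> nat) multiset \<Rightarrow> 'v multiset" where
  "unravel D \<equiv> (\<Sum>x\<in>#D. thetas E (snd x) {#fst x#})"

text \<open>
  A step replaces one occurrence of \<open>w\<close>, so in its descendants one replacement fewer is
  outstanding. Increasing \<open>p\<close> by one first makes sure that there is an outstanding one at \<open>w\<close>.
\<close>

lemma graph_steps_unravel:
  assumes "graph_steps (verts E) (in_nbrs E) F G"
  shows "\<exists>p D. image_mset fst D = G \<and> thetas E p F = unravel D"
  using assms
proof (induction rule: rtranclp_induct)
  case base
  show ?case
    by (intro exI[of _ 0] exI[of _ "image_mset (\<lambda>w. (w, 0)) F"])
      (simp add: image_mset.compositionality comp_def)
next
  case (step G H)
  then obtain p D where D: "image_mset fst D = G" "thetas E p F = unravel D" by blast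
  from step(2) obtain w G0 where w: "G = add_mset w G0" "H = G0 + in_nbrs E w"
    by (auto elim: graph_step.cases)
  with D(1) obtain a D0 where D0: "D = add_mset (w, a) D0" "image_mset fst D0 = G0"
    by (metis msed_map_invR prod.collapse)
  let ?D = "image_mset (\<lambda>x. (fst x, Suc (snd x))) D0 + image_mset (\<lambda>u. (u, a)) (in_nbrs E w)"
  have "thetas E (Suc p) F = theta E (unravel D0) + thetas E a (in_nbrs E w)"
    using D(2) by (simp add: D0(1) funpow_swap1)
  also have "theta E (unravel D0) = (\<Sum>x\<in>#D0. thetas E (Suc (snd x)) {#fst x#})"
    by (induction D0) auto
  also have "thetas E a (in_nbrs E w) = (\<Sum>u\<in>#in_nbrs E w. thetas E a {#u#})"
    by (rule thetas_conv_singletons)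
  finally have "thetas E (Suc p) F = unravel ?D"
    by (simp add: image_mset.compositionality comp_def)
  moreover have "image_mset fst ?D = H"
    using D0(2) w(2) by (simp add: image_mset.compositionality comp_def)
  ultimately show ?case by blast
qed

lemma graph_steps_lift:
  assumes "graph_steps R d (proj F) C" and "set_mset F \<subseteq> verts E"
  shows "\<exists>G. graph_steps (verts E) (in_nbrs E) F G \<and> proj G = C \<and> set_mset G \<subseteq> verts E"
  using assms(1)
proof (induction rule: rtranclp_induct)
  case base
  show ?case using assms(2) by blast
next
  case (step C C')
  then obtain G where G: "graph_steps (verts E) (in_nbrs E) F G" "proj G = C" "set_mset G \<subseteq> verts E"
    by blast
  from step(2) obtain x C0 where x: "C = add_mset x C0" "C' = C0 + d x"
    by (auto elim: graph_step.cases)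
  then have "proj G = add_mset x C0" using G(2) by simp
  from msed_map_invR[OF this] obtain v G0 where v: "G = add_mset v G0" "\<pi> v = x" "proj G0 = C0"
    by auto
  have "graph_step (verts E) (in_nbrs E) G (G0 + in_nbrs E v)"
    using G(3) v(1) by (auto intro: graph_step.intros)
  moreover have "proj (G0 + in_nbrs E v) = C'"
    using v x G(3) in_nbrs_image by auto
  ultimately show ?case
    using G v(1) set_in_nbrs[of v]
    by (intro exI[of _ "G0 + in_nbrs E v"]) auto
qed

text \<open>
  The equation between the images matches the occurrences in pairs \<open>(w, a)\<close>, \<open>(w', a')\<close> with \<open>w\<close> and
  \<open>w'\<close> in one orbit. The group moves \<open>\<Theta>\<^sup>a 1\<^sub>w\<close> to \<open>\<Theta>\<^sup>a 1\<^sub>w\<^sub>'\<close>, which is related to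
  \<open>\<Theta>\<^sup>a\<^sup>' 1\<^sub>w\<^sub>'\<close> by \<open>sim_Theta\<close>.
\<close>

lemma piecewise_unravel:
  assumes "image_mset (\<pi> \<circ> fst) D = image_mset (\<pi> \<circ> fst) D'"
    and "fst ` set_mset D \<subseteq> verts E" and "fst ` set_mset D' \<subseteq> verts E"
  shows "piecewise \<Gamma> E \<alpha> (count (unravel D)) (count (unravel D'))"
  using assms
proof (induction D arbitrary: D')
  case empty
  then show ?case using piecewise_zero by (simp add: zero_multiset.rep_eq)
next
  case (add x D)
  then have "image_mset (\<pi> \<circ> fst) D' = add_mset (\<pi> (fst x)) (image_mset (\<pi> \<circ> fst) D)"
    by (simp add: comp_def)
  from msed_map_invR[OF this] obtain x' D0
    where D': "D' = add_mset x' D0" "\<pi> (fst x') = \<pi> (fst x)"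
      "image_mset (\<pi> \<circ> fst) D0 = image_mset (\<pi> \<circ> fst) D"
    by auto
  define w w' a a' where "w = fst x" "w' = fst x'" "a = snd x" "a' = snd x'"
  have verts: "w \<in> verts E" "w' \<in> verts E"
    using add.prems D'(1) by (auto simp: w_w'_a_a'_def)
  then obtain g where g: "g \<in> carrier \<Gamma>" "\<alpha> g w = w'"
    using D'(2) same_image_iff[of w w'] by (auto simp: w_w'_a_a'_def)
  let ?a = "thetas E a {#w#}" and ?b = "thetas E a {#w'#}" and ?c = "thetas E a' {#w'#}"
  have sets: "set_mset ?a \<subseteq> verts E" "set_mset ?b \<subseteq> verts E" "set_mset ?c \<subseteq> verts E"
    using verts by (auto intro!: set_thetas)
  have "?b = image_mset (\<alpha> g) ?a"
    using thetas_action[OF g(1), of "{#w#}" a] verts g(2) by simp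
  then have "sim_Gamma \<Gamma> E \<alpha> (count ?a) (count ?b)"
    using sim_Gamma_iff sets g(1) by blast
  moreover have "Theta E a' (count ?b) = Theta E a (count ?c)"
    using sets funpow_add[of a' a "theta E"] funpow_add[of a a' "theta E"]
    by (simp add: Theta_count comp_def fun_eq_iff add.commute)
  then have "sim_Theta E (count ?b) (count ?c)" by (auto simp: sim_Theta_def)
  moreover have "piecewise \<Gamma> E \<alpha> (count (unravel D)) (count (unravel D0))"
    using add.IH[of D0] add.prems D' by auto
  ultimately have "piecewise \<Gamma> E \<alpha> (\<lambda>v. count (unravel D) v + count ?a v)
      (\<lambda>v. count (unravel D0) v + count ?c v)"
    using sets by (intro piecewise_add) auto
  moreover have "(\<lambda>v. count M v + count N v) = count (M + N)" for M N :: "'v multiset"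
    by (simp add: fun_eq_iff)
  ultimately show ?case
    by (simp add: D'(1) w_w'_a_a'_def add.commute)
qed

text \<open>
  The common reduct \<open>C1 + C2\<close> of \<open>proj F + Z\<close> and \<open>proj G\<close> consists of the part \<open>C1\<close> that descends
  from \<open>F\<close> and the part \<open>C2\<close> that descends from \<open>Z\<close>. The vertices of the lifted reduct of \<open>G\<close> that
  lie over \<open>C1\<close> are matched with those of the lifted reduct of \<open>F\<close>; those over \<open>C2\<close> form the
  remainder \<open>C\<close>.
\<close>

lemma cong_imp_piecewise:
  assumes "orbit_cong (proj F + Z) (proj G)" and "set_mset F \<subseteq> verts E" "set_mset G \<subseteq> verts E"
  obtains p q A B C where "thetas E p F = A" "thetas E q G = B + C"
    "piecewise \<Gamma> E \<alpha> (count A) (count B)" "Z = {#} \<longrightarrow> C = {#}"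
proof -
  let ?steps = "graph_steps (verts E) (in_nbrs E)" and ?steps' = "graph_steps (\<pi> ` verts E) d"
  from assms(1) obtain C where "?steps' (proj F + Z) C" and GC: "?steps' (proj G) C"
    by (rule graph_cong_common_reduct)
  then obtain C1 C2 where C: "C = C1 + C2" "?steps' (proj F) C1" "?steps' Z C2"
    using graph_steps_split by blast
  obtain F' where F': "?steps F F'" "proj F' = C1" "set_mset F' \<subseteq> verts E"
    using graph_steps_lift[OF C(2) assms(2)] by blast
  obtain G' where G': "?steps G G'" "proj G' = C1 + C2" "set_mset G' \<subseteq> verts E"
    using graph_steps_lift[OF GC assms(3)] C(1) by blast
  obtain p D where D: "image_mset fst D = F'" "thetas E p F = unravel D"
    using graph_steps_unravel[OF F'(1)] by blast
  obtain q D' where D': "image_mset fst D' = G'" "thetas E q G = unravel D'"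
    using graph_steps_unravel[OF G'(1)] by blast
  have "image_mset (\<pi> \<circ> fst) D' = C1 + C2"
    using D'(1) G'(2) by (simp flip: image_mset.compositionality)
  then obtain D1 D2 where D12: "D' = D1 + D2" "C1 = image_mset (\<pi> \<circ> fst) D1" "C2 = image_mset (\<pi> \<circ> fst) D2"
    using image_mset_eq_plusD by blast
  show ?thesis
  proof (rule that)
    show "thetas E p F = unravel D" by (rule D)
    show "thetas E q G = unravel D1 + unravel D2" using D'(2) D12(1) by simp
    show "piecewise \<Gamma> E \<alpha> (count (unravel D)) (count (unravel D1))"
    proof (rule piecewise_unravel)
      show "image_mset (\<pi> \<circ> fst) D = image_mset (\<pi> \<circ> fst) D1"
        using D(1) F'(2) D12(2) by (simp flip: image_mset.compositionality)
      show "fst ` set_mset D \<subseteq> verts E" "fst ` set_mset D1 \<subseteq> verts E"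
        using D(1) F'(3) D'(1) G'(3) D12(1) by (metis set_image_mset,
          metis image_mset_union le_sup_iff set_image_mset set_mset_union)
    qed
    show "Z = {#} \<longrightarrow> unravel D2 = {#}"
      using C(3) D12(3) graph_steps_empty by fastforce
  qed
qed

lemma sim_Theta_thetas:
  assumes "set_mset F \<subseteq> verts E" "thetas E p F = A"
  shows "sim_Theta E (count F) (count A)" "sim_Theta E (count A) (count F)"
proof -
  have "Theta E p (count F) = Theta E 0 (count A)"
    using assms set_thetas[OF assms(1), of p] by (simp add: Theta_count)
  then show "sim_Theta E (count F) (count A)" "sim_Theta E (count A) (count F)"
    unfolding sim_Theta_def by metis+
qed

text \<open>
  The right-hand side is an additive equivalence relation that mentions the group only through the
  orbit map. This is how the left-hand side is seen to be one, too.
\<close>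

theorem sim_iff_cong:
  assumes "set_mset F \<subseteq> verts E" "set_mset G \<subseteq> verts E"
  shows "sim \<Gamma> E \<alpha> (count F) (count G) \<longleftrightarrow> orbit_cong (proj F) (proj G)"
proof
  assume "sim \<Gamma> E \<alpha> (count F) (count G)"
  then obtain a b where ab: "sim_Theta E (count F) a" "piecewise \<Gamma> E \<alpha> a b" "sim_Theta E b (count G)"
    by (auto simp: sim_iff_piecewise)
  from ab(2) obtain A B where "a = count A" "b = count B"
    "set_mset A \<subseteq> verts E" "set_mset B \<subseteq> verts E" "orbit_cong (proj A) (proj B)"
    by (rule piecewise_imp_cong)
  with ab show "orbit_cong (proj F) (proj G)"
    using sim_Theta_imp_cong assms by (meson graph_cong_trans)
next
  assume "orbit_cong (proj F) (proj G)"
  then have "orbit_cong (proj F + {#}) (proj G)" by simp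
  then obtain p q A B C where ABC: "thetas E p F = A" "thetas E q G = B + C"
    "piecewise \<Gamma> E \<alpha> (count A) (count B)" "C = {#}"
    by (rule cong_imp_piecewise[OF _ assms]) (use that in auto)
  then show "sim \<Gamma> E \<alpha> (count F) (count G)"
    using sim_Theta_thetas(1)[OF assms(1) ABC(1)] sim_Theta_thetas(2)[OF assms(2) ABC(2)]
    by (auto simp: sim_iff_piecewise)
qed

theorem precsim_iff_le:
  assumes "set_mset F \<subseteq> verts E" "set_mset G \<subseteq> verts E"
  shows "precsim \<Gamma> E \<alpha> (count F) (count G) \<longleftrightarrow> orbit_le (proj F) (proj G)"
proof
  assume "precsim \<Gamma> E \<alpha> (count F) (count G)"
  then obtain a b c where ab: "sim_Theta E (count F) a" "piecewise \<Gamma> E \<alpha> a b"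
      "c \<in> Cc E" "b \<le> c" "sim_Theta E c (count G)"
    by (auto simp: precsim_iff_piecewise)
  from ab(2) obtain A B where AB: "a = count A" "b = count B"
    "set_mset A \<subseteq> verts E" "set_mset B \<subseteq> verts E" "orbit_cong (proj A) (proj B)"
    by (rule piecewise_imp_cong)
  from ab(3) obtain C where C: "c = count C" "set_mset C \<subseteq> verts E" by (auto simp: Cc_iff)
  then obtain Z where Z: "C = B + Z"
    using ab(4) AB(2) by (auto simp: le_fun_def subset_mset.le_iff_add simp flip: subseteq_mset_def)
  have "orbit_cong (proj F) (proj B)"
    using sim_Theta_imp_cong[of F A] assms(1) AB ab(1) graph_cong_trans by blast
  then have "orbit_cong (proj F + proj Z) (proj C)"
    using Z by (simp add: graph_cong_add_right)
  moreover have "orbit_cong (proj C) (proj G)"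
    using sim_Theta_imp_cong C assms(2) ab(5) by blast
  ultimately show "orbit_le (proj F) (proj G)"
    unfolding graph_le_def by (meson graph_cong_trans)
next
  assume "orbit_le (proj F) (proj G)"
  then obtain Z where "orbit_cong (proj F + Z) (proj G)" by (auto simp: graph_le_def)
  then obtain p q A B C where ABC: "thetas E p F = A" "thetas E q G = B + C"
    "piecewise \<Gamma> E \<alpha> (count A) (count B)" "Z = {#} \<longrightarrow> C = {#}"
    by (rule cong_imp_piecewise[OF _ assms]) (rule that)
  have "count (B + C) \<in> Cc E"
    using set_thetas[OF assms(2), of q] ABC(2) by simp
  moreover have "count B \<le> count (B + C)" by (simp add: le_fun_def)
  ultimately show "precsim \<Gamma> E \<alpha> (count F) (count G)"
    using sim_Theta_thetas(1)[OF assms(1) ABC(1)] sim_Theta_thetas(2)[OF assms(2) ABC(2)] ABC(3)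
    unfolding precsim_iff_piecewise by blast
qed

end

section \<open>Preordered monoids presented by relations on multisets\<close>

lemma set_mset_repeat_subset: "set_mset (repeat_mset n A) \<subseteq> set_mset A"
  by (induction n) auto

text \<open>
  A preordered monoid is described by a map \<open>q\<close> from the free commutative monoid on \<open>X\<close> onto its
  carrier, by the kernel \<open>K\<close> of \<open>q\<close> and by the order \<open>L\<close> pulled back along \<open>q\<close>. These data
  determine it up to an isomorphism that respects the generators.
\<close>

locale monoid_presentation =
  fixes M :: "('a, 'm) preordered_monoid_scheme" (structure)
    and q :: "'x multiset \<Rightarrow> 'a"
    and X :: "'x set"
    and K L :: "'x multiset \<Rightarrow> 'x multiset \<Rightarrow> bool"
  assumes carrier_eq: "carrier M = q ` {A. set_mset A \<subseteq> X}"
    and mult_eq: "\<lbrakk>set_mset A \<subseteq> X; set_mset B \<subseteq> X\<rbrakk> \<Longrightarrow> q A \<otimes> q B = q (A + B)"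
    and one_eq: "\<one> = q {#}"
    and eq_iff: "\<lbrakk>set_mset A \<subseteq> X; set_mset B \<subseteq> X\<rbrakk> \<Longrightarrow> q A = q B \<longleftrightarrow> K A B"
    and leq_iff: "\<lbrakk>set_mset A \<subseteq> X; set_mset B \<subseteq> X\<rbrakk> \<Longrightarrow> leq M (q A) (q B) \<longleftrightarrow> L A B"
begin

lemma carrierE:
  assumes "x \<in> carrier M"
  obtains A where "x = q A" "set_mset A \<subseteq> X"
  using assms carrier_eq by auto

lemma class_in_carrier: "set_mset A \<subseteq> X \<Longrightarrow> q A \<in> carrier M"
  by (simp add: carrier_eq)

lemma comm_monoid: "comm_monoid M"
  by unfold_locales
    (auto simp: one_eq mult_eq class_in_carrier ac_simps elim!: carrierE)

lemma preordered_monoid: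
  assumes "\<And>A. L A A" and "\<And>A B C. L A B \<Longrightarrow> L B C \<Longrightarrow> L A C"
    and "\<And>A B C. L A B \<Longrightarrow> L (A + C) (B + C)"
  shows "preordered_monoid M"
proof -
  interpret comm_monoid M by (rule comm_monoid)
  show ?thesis
    by unfold_locales
      (auto simp: mult_eq leq_iff elim!: carrierE intro: assms)
qed

lemma pow_eq:
  assumes "set_mset A \<subseteq> X"
  shows "q A [^] (n::nat) = q (repeat_mset n A)"
proof (induction n)
  case (Suc n)
  have "set_mset (repeat_mset n A) \<subseteq> X"
    by (rule subset_trans[OF set_mset_repeat_subset assms])
  then show ?case
    using Suc assms by (simp add: nat_pow_def mult_eq add.commute)
qed (simp add: nat_pow_def one_eq)

lemma unperforated:
  assumes "\<And>n A B. n \<ge> 1 \<Longrightarrow> L (repeat_mset n A) (repeat_mset n B) \<Longrightarrow> L A B"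
  shows "unperforated M"
  unfolding unperforated_def
proof (intro ballI allI impI)
  fix x y and n :: nat
  assume "x \<in> carrier M" "y \<in> carrier M" and n: "n \<ge> 1" "leq M (x [^] n) (y [^] n)"
  then obtain A B where AB: "x = q A" "y = q B" "set_mset A \<subseteq> X" "set_mset B \<subseteq> X"
    by (metis carrierE)
  have "set_mset (repeat_mset n C) \<subseteq> X" if "set_mset C \<subseteq> X" for C
    by (rule subset_trans[OF set_mset_repeat_subset that])
  then show "leq M x y"
    using AB n assms[of n A B] by (simp add: pow_eq leq_iff)
qed

end

lemma monoid_presentation_iso:
  assumes "monoid_presentation M q X K L" and "monoid_presentation N q' X K L"
  obtains h where "h \<in> preordered_monoid_iso M N" "\<And>A. set_mset A \<subseteq> X \<Longrightarrow> h (q A) = q' A"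
proof -
  interpret M: monoid_presentation M q X K L by fact
  interpret N: monoid_presentation N q' X K L by fact
  define h where "h x = q' (SOME A. set_mset A \<subseteq> X \<and> x = q A)" for x
  have h: "h (q A) = q' A" if A: "set_mset A \<subseteq> X" for A
  proof -
    let ?B = "SOME B. set_mset B \<subseteq> X \<and> q A = q B"
    have "set_mset ?B \<subseteq> X \<and> q A = q ?B"
      by (rule someI[of _ A]) (simp add: A)
    then have "q' ?B = q' A"
      using A by (metis M.eq_iff N.eq_iff)
    then show ?thesis by (simp add: h_def)
  qed
  have "h \<in> hom M N"
    by (rule homI) (auto simp: h M.mult_eq N.mult_eq N.class_in_carrier elim!: M.carrierE)
  moreover have "bij_betw h (carrier M) (carrier N)"
  proof (rule bij_betwI')
    fix x y assume "x \<in> carrier M" "y \<in> carrier M"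
    then show "(h x = h y) \<longleftrightarrow> x = y"
      by (auto simp: h M.eq_iff N.eq_iff elim!: M.carrierE)
  next
    show "h x \<in> carrier N" if "x \<in> carrier M" for x
      using that by (auto simp: h N.class_in_carrier elim!: M.carrierE)
    show "\<exists>x\<in>carrier M. y = h x" if "y \<in> carrier N" for y
      using that by (metis N.carrierE M.class_in_carrier h)
  qed
  moreover have "leq M x y \<longleftrightarrow> leq N (h x) (h y)" if "x \<in> carrier M" "y \<in> carrier M" for x y
    using that by (auto simp: h M.leq_iff N.leq_iff elim!: M.carrierE)
  ultimately have "h \<in> preordered_monoid_iso M N"
    by (simp add: preordered_monoid_iso_def iso_def)
  with h show ?thesis using that by blast
qed

section \<open>The monoids of an action\<close>

context orbit_map
begin

text \<open>
  The class of \<open>A\<close>, realised as a set of functions on the vertices of \<open>E\<close>. It is empty unless \<open>A\<close> is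
  related to the image of a multiset of vertices; for \<open>A\<close> supported in the image of \<open>\<pi>\<close>, \<open>proj_surj\<close>
  provides a representative.
\<close>

definition cong_class :: "('x multiset \<Rightarrow> 'x multiset \<Rightarrow> bool) \<Rightarrow> 'x multiset \<Rightarrow> ('v \<Rightarrow> nat) set" where
  "cong_class K A = {count F | F. set_mset F \<subseteq> verts E \<and> K A (proj F)}"

lemma proj_surj:
  assumes "set_mset A \<subseteq> \<pi> ` verts E"
  obtains F where "set_mset F \<subseteq> verts E" "proj F = A"
proof -
  have "\<exists>F. set_mset F \<subseteq> verts E \<and> proj F = A"
    using assms
  proof (induction A)
    case (add x A)
    then obtain F v where "set_mset F \<subseteq> verts E" "proj F = A" "v \<in> verts E" "\<pi> v = x" by auto
    then show ?case by (intro exI[of _ "add_mset v F"]) simp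
  qed simp
  then show ?thesis using that by blast
qed

lemma set_proj: "set_mset F \<subseteq> verts E \<Longrightarrow> set_mset (proj F) \<subseteq> \<pi> ` verts E"
  by auto

text \<open>
  Both \<open>sim_rel\<close> and \<open>approx_rel\<close> are pulled back along \<open>proj\<close> from an additive equivalence
  relation on multisets of orbits, so their quotients are computed together.
\<close>

lemma quotient_presentation:
  assumes rel: "\<And>F f'. (count F, f') \<in> Q \<longleftrightarrow> set_mset F \<subseteq> verts E
      \<and> (\<exists>G. f' = count G \<and> set_mset G \<subseteq> verts E \<and> K (proj F) (proj G))"
    and equiv: "equivp K"
    and add: "\<forall>A B C D. K A B \<and> K C D \<longrightarrow> K (A + C) (B + D)"
  shows "set_mset F \<subseteq> verts E \<Longrightarrow> Q `` {count F} = cong_class K (proj F)" (is "_ \<Longrightarrow> ?class F")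
    and "Cc E // Q = cong_class K ` {A. set_mset A \<subseteq> \<pi> ` verts E}" (is ?carrier)
    and "\<lbrakk>set_mset A \<subseteq> \<pi> ` verts E; set_mset B \<subseteq> \<pi> ` verts E\<rbrakk>
      \<Longrightarrow> class_add Q (cong_class K A) (cong_class K B) = cong_class K (A + B)"
    and "\<lbrakk>set_mset A \<subseteq> \<pi> ` verts E; set_mset B \<subseteq> \<pi> ` verts E\<rbrakk>
      \<Longrightarrow> cong_class K A = cong_class K B \<longleftrightarrow> K A B"
proof -
  have K: "K A A" "K A B \<Longrightarrow> K B A" "K A B \<Longrightarrow> K B C \<Longrightarrow> K A C" for A B C
    using equiv by (auto intro: equivp_reflp equivp_symp equivp_transp)
  show cls: "?class F" if "set_mset F \<subseteq> verts E" for F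
    using rel that by (auto simp: cong_class_def)
  have "Cc E // Q = {Q `` {count F} | F. set_mset F \<subseteq> verts E}"
    unfolding quotient_def by (force simp: Cc_iff)
  also have "\<dots> = cong_class K ` proj ` {F. set_mset F \<subseteq> verts E}"
    using cls by auto
  also have "proj ` {F. set_mset F \<subseteq> verts E} = {A. set_mset A \<subseteq> \<pi> ` verts E}"
  proof (intro equalityI subsetI)
    fix A assume "A \<in> proj ` {F. set_mset F \<subseteq> verts E}"
    then obtain F where "A = proj F" "set_mset F \<subseteq> verts E" by blast
    then show "A \<in> {A. set_mset A \<subseteq> \<pi> ` verts E}" using set_proj by simp
  next
    fix A assume "A \<in> {A. set_mset A \<subseteq> \<pi> ` verts E}"
    then have "set_mset A \<subseteq> \<pi> ` verts E" by simp
    then obtain F where "set_mset F \<subseteq> verts E" "proj F = A" by (rule proj_surj)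
    then show "A \<in> proj ` {F. set_mset F \<subseteq> verts E}" by blast
  qed
  finally show ?carrier .
  have same: "cong_class K A = cong_class K B" if "K A B" for A B
    using that K unfolding cong_class_def by blast
  show "cong_class K A = cong_class K B \<longleftrightarrow> K A B" if A: "set_mset A \<subseteq> \<pi> ` verts E"
  proof
    obtain F where "set_mset F \<subseteq> verts E" "proj F = A" using proj_surj[OF A] .
    moreover assume "cong_class K A = cong_class K B"
    moreover have "count F \<in> cong_class K (proj F)"
      using K(1) calculation(1) by (auto simp: cong_class_def)
    ultimately have "count F \<in> cong_class K B" by simp
    then show "K A B"
      using K(2) \<open>proj F = A\<close> by (auto simp: cong_class_def count_inject)
  qed (rule same)
  show "class_add Q (cong_class K A) (cong_class K B) = cong_class K (A + B)"
    if A: "set_mset A \<subseteq> \<pi> ` verts E" and B: "set_mset B \<subseteq> \<pi> ` verts E"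
  proof -
    have sum: "Q `` {\<lambda>v. f v + f' v} = cong_class K (A + B)"
      if "f \<in> cong_class K A" "f' \<in> cong_class K B" for f f'
    proof -
      obtain F G where FG: "f = count F" "f' = count G" "set_mset F \<subseteq> verts E" "set_mset G \<subseteq> verts E"
        "K A (proj F)" "K B (proj G)"
        using \<open>f \<in> cong_class K A\<close> \<open>f' \<in> cong_class K B\<close> by (auto simp: cong_class_def)
      have "(\<lambda>v. f v + f' v) = count (F + G)" using FG(1,2) by (simp add: fun_eq_iff)
      moreover have "Q `` {count (F + G)} = cong_class K (proj (F + G))"
        using FG(3,4) by (intro cls) simp
      ultimately have "Q `` {\<lambda>v. f v + f' v} = cong_class K (proj (F + G))"
        by (simp only:)
      also have "\<dots> = cong_class K (A + B)"
        using add FG(5,6) by (intro same[symmetric]) simp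
      finally show ?thesis .
    qed
    obtain F G where "set_mset F \<subseteq> verts E" "proj F = A" "set_mset G \<subseteq> verts E" "proj G = B"
      using proj_surj[OF A] proj_surj[OF B] by metis
    then have "count F \<in> cong_class K A" "count G \<in> cong_class K B"
      using K(1) by (auto simp: cong_class_def)
    then show ?thesis
      unfolding class_add_def using sum by blast
  qed
qed

lemma in_nbrs_closed: "x \<in> \<pi> ` verts E \<Longrightarrow> set_mset (d x) \<subseteq> \<pi> ` verts E"
  using in_nbrs_image set_in_nbrs by fastforce

abbreviation orbit_approx :: "'x multiset \<Rightarrow> 'x multiset \<Rightarrow> bool" where
  "orbit_approx A B \<equiv> orbit_le A B \<and> orbit_le B A"

lemma sim_rel_iff:
  "(count F, f') \<in> sim_rel \<Gamma> E \<alpha> \<longleftrightarrow> set_mset F \<subseteq> verts E \<and>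
     (\<exists>G. f' = count G \<and> set_mset G \<subseteq> verts E \<and> orbit_cong (proj F) (proj G))"
  by (auto simp: sim_rel_def Cc_iff sim_iff_cong count_inject)

lemma approx_rel_iff:
  "(count F, f') \<in> approx_rel \<Gamma> E \<alpha> \<longleftrightarrow> set_mset F \<subseteq> verts E \<and>
     (\<exists>G. f' = count G \<and> set_mset G \<subseteq> verts E \<and> orbit_approx (proj F) (proj G))"
  by (auto simp: approx_rel_def Cc_iff precsim_iff_le count_inject)

lemma equivp_orbit_approx: "equivp orbit_approx"
  by (rule equivpI) (auto simp: reflp_def symp_def transp_def intro: graph_le_refl graph_le_trans)

lemma orbit_approx_add:
  "\<forall>A B C D. orbit_approx A B \<and> orbit_approx C D \<longrightarrow> orbit_approx (A + C) (B + D)"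
  by (simp add: graph_le_add)

lemma orbit_cong_add: "\<forall>A B C D. orbit_cong A B \<and> orbit_cong C D \<longrightarrow> orbit_cong (A + C) (B + D)"
  by (simp add: graph_cong_add)

lemmas V_quotient = quotient_presentation[OF sim_rel_iff equivp_evquivclp orbit_cong_add]
lemmas W_quotient = quotient_presentation[OF approx_rel_iff equivp_orbit_approx orbit_approx_add]

lemma complement_support:
  assumes "orbit_cong (A + Z) B" and "set_mset B \<subseteq> \<pi> ` verts E"
  shows "set_mset Z \<subseteq> \<pi> ` verts E"
  using graph_cong_support[OF assms(1)] in_nbrs_closed assms(2) by auto

lemma V_presentation:
  "monoid_presentation (V_monoid \<Gamma> E \<alpha>) (cong_class orbit_cong) (\<pi> ` verts E) orbit_cong orbit_le"
proof unfold_locales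
  let ?q = "cong_class orbit_cong"
  show "carrier (V_monoid \<Gamma> E \<alpha>) = ?q ` {A. set_mset A \<subseteq> \<pi> ` verts E}"
    by (simp add: V_monoid_def V_quotient(2))
  show "\<one>\<^bsub>V_monoid \<Gamma> E \<alpha>\<^esub> = ?q {#}"
  proof -
    have "\<one>\<^bsub>V_monoid \<Gamma> E \<alpha>\<^esub> = sim_rel \<Gamma> E \<alpha> `` {count {#}}"
      by (simp only: V_monoid_def monoid.select_convs zero_multiset.rep_eq)
    also have "\<dots> = ?q (proj {#})" by (rule V_quotient(1)) simp
    finally show ?thesis by simp
  qed
  fix A B assume AB: "set_mset A \<subseteq> \<pi> ` verts E" "set_mset B \<subseteq> \<pi> ` verts E"
  show "?q A \<otimes>\<^bsub>V_monoid \<Gamma> E \<alpha>\<^esub> ?q B = ?q (A + B)"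
    using V_quotient(3)[OF AB] by (simp add: V_monoid_def)
  show "?q A = ?q B \<longleftrightarrow> orbit_cong A B"
    by (rule V_quotient(4)[OF AB])
  have "leq (V_monoid \<Gamma> E \<alpha>) (?q A) (?q B)
      \<longleftrightarrow> (\<exists>Z. set_mset Z \<subseteq> \<pi> ` verts E \<and> class_add (sim_rel \<Gamma> E \<alpha>) (?q A) (?q Z) = ?q B)"
    by (auto simp: V_monoid_def V_quotient(2))
  also have "\<dots> \<longleftrightarrow> (\<exists>Z. set_mset Z \<subseteq> \<pi> ` verts E \<and> orbit_cong (A + Z) B)"
    using AB by (intro ex_cong1 conj_cong refl) (subst V_quotient(3), simp_all add: V_quotient(4))
  also have "\<dots> \<longleftrightarrow> orbit_le A B"
    using complement_support AB(2) unfolding graph_le_def by blast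
  finally show "leq (V_monoid \<Gamma> E \<alpha>) (?q A) (?q B) \<longleftrightarrow> orbit_le A B" .
qed

lemma W_presentation:
  "monoid_presentation (W_monoid \<Gamma> E \<alpha>) (cong_class orbit_approx) (\<pi> ` verts E) orbit_approx orbit_le"
proof unfold_locales
  let ?q = "cong_class orbit_approx"
  show "carrier (W_monoid \<Gamma> E \<alpha>) = ?q ` {A. set_mset A \<subseteq> \<pi> ` verts E}"
    by (simp add: W_monoid_def W_quotient(2))
  show "\<one>\<^bsub>W_monoid \<Gamma> E \<alpha>\<^esub> = ?q {#}"
  proof -
    have "\<one>\<^bsub>W_monoid \<Gamma> E \<alpha>\<^esub> = approx_rel \<Gamma> E \<alpha> `` {count {#}}"
      by (simp only: W_monoid_def monoid.select_convs zero_multiset.rep_eq)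
    also have "\<dots> = ?q (proj {#})" by (rule W_quotient(1)) simp
    finally show ?thesis by simp
  qed
  fix A B assume AB: "set_mset A \<subseteq> \<pi> ` verts E" "set_mset B \<subseteq> \<pi> ` verts E"
  show "?q A \<otimes>\<^bsub>W_monoid \<Gamma> E \<alpha>\<^esub> ?q B = ?q (A + B)"
    using W_quotient(3)[OF AB] by (simp add: W_monoid_def)
  show "?q A = ?q B \<longleftrightarrow> orbit_approx A B"
    by (rule W_quotient(4)[OF AB])
  have "leq (W_monoid \<Gamma> E \<alpha>) (?q A) (?q B)
      \<longleftrightarrow> (\<exists>F G. set_mset F \<subseteq> verts E \<and> set_mset G \<subseteq> verts E \<and> orbit_approx A (proj F)
            \<and> orbit_approx B (proj G) \<and> orbit_le (proj F) (proj G))"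
  proof -
    have "leq (W_monoid \<Gamma> E \<alpha>) (?q A) (?q B)
        \<longleftrightarrow> (\<exists>F G. set_mset F \<subseteq> verts E \<and> set_mset G \<subseteq> verts E \<and> orbit_approx A (proj F)
              \<and> orbit_approx B (proj G) \<and> precsim \<Gamma> E \<alpha> (count F) (count G))"
      unfolding W_monoid_def cong_class_def by simp blast
    also have "\<dots> \<longleftrightarrow> (\<exists>F G. set_mset F \<subseteq> verts E \<and> set_mset G \<subseteq> verts E \<and> orbit_approx A (proj F)
              \<and> orbit_approx B (proj G) \<and> orbit_le (proj F) (proj G))"
      by (intro ex_cong1 conj_cong refl precsim_iff_le)
    finally show ?thesis .
  qed
  also have "\<dots> \<longleftrightarrow> orbit_le A B"
  proof
    assume "orbit_le A B"
    then show "\<exists>F G. set_mset F \<subseteq> verts E \<and> set_mset G \<subseteq> verts E \<and> orbit_approx A (proj F)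
            \<and> orbit_approx B (proj G) \<and> orbit_le (proj F) (proj G)"
      using proj_surj[OF AB(1)] proj_surj[OF AB(2)] graph_le_refl by metis
  qed (blast intro: graph_le_trans)
  finally show "leq (W_monoid \<Gamma> E \<alpha>) (?q A) (?q B) \<longleftrightarrow> orbit_le A B" .
qed

lemma indicator_eq_count: "indicator {v} = count {#v#}"
  by (auto simp: fun_eq_iff indicator_def)

lemma V_class_vertex:
  assumes "v \<in> verts E"
  shows "V_class \<Gamma> E \<alpha> (indicator {v}) = cong_class orbit_cong {#\<pi> v#}"
proof -
  have "V_class \<Gamma> E \<alpha> (indicator {v}) = sim_rel \<Gamma> E \<alpha> `` {count {#v#}}"
    by (simp only: V_class_def indicator_eq_count)
  also have "\<dots> = cong_class orbit_cong (proj {#v#})"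
    by (rule V_quotient(1)) (simp add: assms)
  finally show ?thesis by simp
qed

lemma W_class_vertex:
  assumes "v \<in> verts E"
  shows "W_class \<Gamma> E \<alpha> (indicator {v}) = cong_class orbit_approx {#\<pi> v#}"
proof -
  have "W_class \<Gamma> E \<alpha> (indicator {v}) = approx_rel \<Gamma> E \<alpha> `` {count {#v#}}"
    by (simp only: W_class_def indicator_eq_count)
  also have "\<dots> = cong_class orbit_approx (proj {#v#})"
    by (rule W_quotient(1)) (simp add: assms)
  finally show ?thesis by simp
qed

theorem V_preordered_monoid: "preordered_monoid (V_monoid \<Gamma> E \<alpha>)"
  by (rule monoid_presentation.preordered_monoid[OF V_presentation])
    (rule graph_le_refl, erule (1) graph_le_trans, erule graph_le_add_right)

theorem W_preordered_monoid: "preordered_monoid (W_monoid \<Gamma> E \<alpha>)"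
  by (rule monoid_presentation.preordered_monoid[OF W_presentation])
    (rule graph_le_refl, erule (1) graph_le_trans, erule graph_le_add_right)

theorem V_unperforated: "unperforated (V_monoid \<Gamma> E \<alpha>)"
  by (rule monoid_presentation.unperforated[OF V_presentation]) (erule (1) graph_le_unperforated)

theorem W_unperforated: "unperforated (W_monoid \<Gamma> E \<alpha>)"
  by (rule monoid_presentation.unperforated[OF W_presentation]) (erule (1) graph_le_unperforated)

end

section \<open>The quotient graph\<close>

lemma (in group_action) same_orbit_iff:
  assumes "u \<in> E" "v \<in> E"
  shows "orbit G \<phi> u = orbit G \<phi> v \<longleftrightarrow> (\<exists>g\<in>carrier G. \<phi> g u = v)"
proof
  assume "orbit G \<phi> u = orbit G \<phi> v"
  then have "v \<in> orbit G \<phi> u" using orbit_refl[OF assms(2)] by simp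
  then show "\<exists>g\<in>carrier G. \<phi> g u = v" by (auto simp: orbit_def)
next
  assume "\<exists>g\<in>carrier G. \<phi> g u = v"
  then have v: "v \<in> orbit G \<phi> u" by (auto simp: orbit_def)
  then have u: "u \<in> orbit G \<phi> v" by (rule orbit_sym[OF assms])
  have "orbit G \<phi> a \<subseteq> orbit G \<phi> b" if "a \<in> E" "b \<in> E" "a \<in> orbit G \<phi> b" for a b
  proof
    fix w assume w: "w \<in> orbit G \<phi> a"
    then have "w \<in> E" using element_image that(1) by (auto simp: orbit_def)
    then show "w \<in> orbit G \<phi> b" using orbit_trans[OF that(2,1)] that(3) w by blast
  qed
  then show "orbit G \<phi> u = orbit G \<phi> v" using assms u v by blast
qed

lemma (in self_similar_action) in_nbrs_action:
  assumes "g \<in> carrier \<Gamma>" "v \<in> verts E"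
  shows "in_nbrs E (\<alpha> g v) = image_mset (\<alpha> g) (in_nbrs E v)"
proof -
  have inj: "inj_on (\<beta> g) (in_arcs E v)"
    using edges.inj_prop[OF assms(1)] by (rule inj_on_subset) auto
  have "in_arcs E (\<alpha> g v) = \<beta> g ` in_arcs E v"
  proof (intro equalityI subsetI)
    fix e assume e: "e \<in> in_arcs E (\<alpha> g v)"
    then obtain e' where e': "e' \<in> arcs E" "\<beta> g e' = e"
      using edges.surj_prop[OF assms(1)] by (metis imageE in_in_arcs_conv)
    then have "\<alpha> g (head E e') = \<alpha> g v" using e range_equivariant assms(1) by auto
    then have "head E e' = v"
      using vertices.inj_prop[OF assms(1)] assms(2) e'(1) by (auto dest: inj_onD)
    then show "e \<in> \<beta> g ` in_arcs E v" using e' by auto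
  next
    fix e assume "e \<in> \<beta> g ` in_arcs E v"
    then show "e \<in> in_arcs E (\<alpha> g v)"
      using assms range_equivariant edges.element_image[OF assms(1)] by auto
  qed
  then have "mset_set (in_arcs E (\<alpha> g v)) = image_mset (\<beta> g) (mset_set (in_arcs E v))"
    using image_mset_mset_set[OF inj] by simp
  moreover have "tail E (\<beta> g e) = \<alpha> g (tail E e)" if "e \<in># mset_set (in_arcs E v)" for e
    using that source_equivariant assms(1) by (cases "finite (in_arcs E v)") auto
  ultimately show ?thesis
    unfolding in_nbrs_def by (simp add: image_mset.compositionality) (rule image_mset_cong, simp)
qed

text \<open>
  Automorphisms carry \<open>r\<^sup>-\<^sup>1(w)\<close> bijectively to \<open>r\<^sup>-\<^sup>1(g w)\<close> and leave the orbits of the sources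
  unchanged. So the edges at a representative describe the edges at every vertex of its orbit, and the
  orbit map is compatible with the rewriting rules.
\<close>

locale self_similar_quotient =
  row_finite_no_sources E + self_similar_action \<Gamma> E \<alpha> \<beta> res
  for \<Gamma> :: "('g, 'm) monoid_scheme" and E :: "('v, 'e) pre_digraph" and \<alpha> \<beta> res +
  fixes \<Omega> :: "'v set"
  assumes representatives: "orbit_representatives \<Gamma> E \<alpha> \<Omega>"
begin

abbreviation quot :: "('v set, 'e) pre_digraph" where
  "quot \<equiv> quotient_graph \<Gamma> E \<alpha> \<Omega>"

lemma verts_quot: "verts quot = orbit \<Gamma> \<alpha> ` verts E"
  by (auto simp: quotient_graph_def orbits_def)

lemma representative:
  assumes "v \<in> verts E"
  obtains g w where "g \<in> carrier \<Gamma>" "w \<in> \<Omega>" "w \<in> verts E" "v = \<alpha> g w"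
    "orbit \<Gamma> \<alpha> w = orbit \<Gamma> \<alpha> v" "in_arcs quot (orbit \<Gamma> \<alpha> v) = in_arcs E w"
proof -
  have \<Omega>: "\<Omega> \<subseteq> verts E" "\<exists>!w. w \<in> \<Omega> \<and> w \<in> orbit \<Gamma> \<alpha> v"
    using representatives assms by (auto simp: orbit_representatives_def orbits_def)
  then obtain w where w: "w \<in> \<Omega>" "w \<in> orbit \<Gamma> \<alpha> v" by blast
  with \<Omega>(1) have "w \<in> verts E" by blast
  have orb: "orbit \<Gamma> \<alpha> w = orbit \<Gamma> \<alpha> v"
    using vertices.same_orbit_iff[OF assms \<open>w \<in> verts E\<close>] w(2) by (auto simp: orbit_def)
  then obtain g where g: "g \<in> carrier \<Gamma>" "\<alpha> g w = v"
    using vertices.same_orbit_iff[OF \<open>w \<in> verts E\<close> assms] by blast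
  have unique: "u = w" if "u \<in> \<Omega>" "orbit \<Gamma> \<alpha> u = orbit \<Gamma> \<alpha> v" for u
    using \<Omega> w that vertices.orbit_refl[of u] by blast
  have "in_arcs quot (orbit \<Gamma> \<alpha> v) = in_arcs E w"
  proof (intro equalityI subsetI)
    fix e assume "e \<in> in_arcs quot (orbit \<Gamma> \<alpha> v)"
    then have "e \<in> arcs E" "head E e \<in> \<Omega>" "orbit \<Gamma> \<alpha> (head E e) = orbit \<Gamma> \<alpha> v"
      by (simp_all add: quotient_graph_def)
    then show "e \<in> in_arcs E w" using unique by simp
  next
    fix e assume "e \<in> in_arcs E w"
    then show "e \<in> in_arcs quot (orbit \<Gamma> \<alpha> v)"
      using w(1) orb by (simp add: quotient_graph_def)
  qed
  then show ?thesis
    by (rule that[OF g(1) w(1) \<open>w \<in> verts E\<close> g(2)[symmetric] orb])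
qed

lemma row_finite_quot: "row_finite_no_sources quot"
proof unfold_locales
  fix e assume "e \<in> arcs quot"
  then have "e \<in> arcs E" by (auto simp: quotient_graph_def)
  then show "tail quot e \<in> verts quot" "head quot e \<in> verts quot"
    by (auto simp: verts_quot) (auto simp: quotient_graph_def)
next
  fix x assume "x \<in> verts quot"
  then obtain v where v: "v \<in> verts E" "x = orbit \<Gamma> \<alpha> v" by (auto simp: verts_quot)
  obtain g w where "w \<in> verts E" "in_arcs quot (orbit \<Gamma> \<alpha> v) = in_arcs E w"
    using representative[OF v(1)] by metis
  then show "finite (in_arcs quot x)" "in_arcs quot x \<noteq> {}"
    using finite_in_arcs in_arcs_nonempty v(2) by auto
qed

lemma in_nbrs_quot:
  assumes "v \<in> verts E"
  shows "in_nbrs quot (orbit \<Gamma> \<alpha> v) = image_mset (orbit \<Gamma> \<alpha>) (in_nbrs E v)"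
proof -
  obtain g w where w: "g \<in> carrier \<Gamma>" "w \<in> verts E" "v = \<alpha> g w"
    "in_arcs quot (orbit \<Gamma> \<alpha> v) = in_arcs E w"
    using representative[OF assms] by metis
  have "orbit \<Gamma> \<alpha> (\<alpha> g u) = orbit \<Gamma> \<alpha> u" if "u \<in> verts E" for u
    using vertices.same_orbit_iff[of u "\<alpha> g u"] vertices.element_image[OF w(1) that] w(1) that by metis
  then have "image_mset (orbit \<Gamma> \<alpha>) (in_nbrs E v) = image_mset (orbit \<Gamma> \<alpha>) (in_nbrs E w)"
    using w set_in_nbrs[of w] by (auto simp: in_nbrs_action image_mset.compositionality intro!: image_mset_cong)
  then show ?thesis
    by (simp add: in_nbrs_def w(4)) (simp add: quotient_graph_def image_mset.compositionality comp_def)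
qed

sublocale action: orbit_map \<Gamma> E \<alpha> "orbit \<Gamma> \<alpha>" "in_nbrs quot"
  by unfold_locales
    (auto simp: in_nbrs_action in_nbrs_quot vertices.same_orbit_iff bij_betw_def
      vertices.inj_prop vertices.surj_prop)

end

text \<open>
  The orbits of the trivial group are singletons, so the identity can serve as the orbit map.
\<close>

lemma trivial_orbit_map:
  assumes "row_finite_no_sources E"
  shows "orbit_map trivial_group1 E (trivial_action E) (\<lambda>v. v) (in_nbrs E)"
proof -
  interpret row_finite_no_sources E by fact
  have "in_nbrs E v = image_mset (\<lambda>v\<in>verts E. v) (in_nbrs E v)" for v
    using set_in_nbrs[of v] by (intro multiset.map_ident_strong[symmetric]) auto
  moreover have "bij_betw (\<lambda>v\<in>verts E. v) (verts E) (verts E)"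
    by (auto simp: bij_betw_def inj_on_def)
  ultimately show ?thesis
    by unfold_locales (auto simp: trivial_action_def)
qed

theorem proposition7p7:
  fixes \<Gamma> :: "('g, 'm) monoid_scheme"
    and E :: "('v, 'e) pre_digraph"
    and \<alpha> :: "'g \<Rightarrow> 'v \<Rightarrow> 'v"
    and \<beta> :: "'g \<Rightarrow> 'e \<Rightarrow> 'e"
    and res :: "'g \<Rightarrow> 'e \<Rightarrow> 'g"
    and \<Omega> :: "'v set"
    and E\<^sub>\<Gamma> :: "('v set, 'e) pre_digraph"
  assumes "row_finite_no_sources E"
    and "self_similar_action \<Gamma> E \<alpha> \<beta> res"
    and "orbit_representatives \<Gamma> E \<alpha> \<Omega>"
    and "E\<^sub>\<Gamma> = quotient_graph \<Gamma> E \<alpha> \<Omega>"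
  shows "preordered_monoid (W_monoid \<Gamma> E \<alpha>) \<and> preordered_monoid (W_graph E\<^sub>\<Gamma>)
       \<and> preordered_monoid (V_monoid \<Gamma> E \<alpha>) \<and> preordered_monoid (V_graph E\<^sub>\<Gamma>)
       \<and> (\<exists>h \<in> preordered_monoid_iso (W_monoid \<Gamma> E \<alpha>) (W_graph E\<^sub>\<Gamma>).
            \<forall>v \<in> verts E. h (W_class \<Gamma> E \<alpha> (indicator {v}))
                         = W_graph_class E\<^sub>\<Gamma> (indicator {orbit \<Gamma> \<alpha> v}))
       \<and> (\<exists>h \<in> preordered_monoid_iso (V_monoid \<Gamma> E \<alpha>) (V_graph E\<^sub>\<Gamma>).
            \<forall>v \<in> verts E. h (V_class \<Gamma> E \<alpha> (indicator {v}))
                         = V_graph_class E\<^sub>\<Gamma> (indicator {orbit \<Gamma> \<alpha> v}))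
       \<and> unperforated (W_monoid \<Gamma> E \<alpha>) \<and> unperforated (V_monoid \<Gamma> E \<alpha>)
       \<and> unperforated (W_graph E\<^sub>\<Gamma>) \<and> unperforated (V_graph E\<^sub>\<Gamma>)"
proof -
  interpret self_similar_quotient \<Gamma> E \<alpha> \<beta> res \<Omega>
    using assms(1-3) by (intro self_similar_quotient.intro self_similar_quotient_axioms.intro)
  interpret quot: orbit_map trivial_group1 quot "trivial_action quot" "\<lambda>x. x" "in_nbrs quot"
    by (rule trivial_orbit_map[OF row_finite_quot])
  have verts: "(\<lambda>x. x) ` verts quot = orbit \<Gamma> \<alpha> ` verts E" by (simp add: verts_quot)
  obtain h where h: "h \<in> preordered_monoid_iso (V_monoid \<Gamma> E \<alpha>) (V_graph quot)"
    "\<And>A. set_mset A \<subseteq> orbit \<Gamma> \<alpha> ` verts E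
      \<Longrightarrow> h (action.cong_class action.orbit_cong A) = quot.cong_class action.orbit_cong A"
    using monoid_presentation_iso[OF action.V_presentation quot.V_presentation[unfolded verts]]
    by blast
  obtain k where k: "k \<in> preordered_monoid_iso (W_monoid \<Gamma> E \<alpha>) (W_graph quot)"
    "\<And>A. set_mset A \<subseteq> orbit \<Gamma> \<alpha> ` verts E
      \<Longrightarrow> k (action.cong_class action.orbit_approx A) = quot.cong_class action.orbit_approx A"
    using monoid_presentation_iso[OF action.W_presentation quot.W_presentation[unfolded verts]]
    by blast
  have orbit_in: "orbit \<Gamma> \<alpha> v \<in> verts quot" if "v \<in> verts E" for v
    using that by (simp add: verts_quot)
  have "h (V_class \<Gamma> E \<alpha> (indicator {v})) = V_graph_class quot (indicator {orbit \<Gamma> \<alpha> v})"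
    if "v \<in> verts E" for v
    using that h(2)[of "{#orbit \<Gamma> \<alpha> v#}"]
    by (simp add: action.V_class_vertex quot.V_class_vertex[OF orbit_in, unfolded verts])
  moreover have "k (W_class \<Gamma> E \<alpha> (indicator {v})) = W_graph_class quot (indicator {orbit \<Gamma> \<alpha> v})"
    if "v \<in> verts E" for v
    using that k(2)[of "{#orbit \<Gamma> \<alpha> v#}"]
    by (simp add: action.W_class_vertex quot.W_class_vertex[OF orbit_in, unfolded verts])
  ultimately show ?thesis
    unfolding assms(4)
    using h(1) k(1)
    by (intro conjI bexI[of _ h] bexI[of _ k] ballI action.V_preordered_monoid action.W_preordered_monoid
        quot.V_preordered_monoid quot.W_preordered_monoid action.V_unperforated action.W_unperforated
        quot.V_unperforated quot.W_unperforated)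
qed

end
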